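(* Suppose that (Smoothness) $\|\nabla f(\mathbf{Y})-\nabla f(\mathbf{X})\|_F\le L\|\mathbf{Y}-\mathbf{X}\|_F$ for all $\mathbf{X},\mathbf{Y}\in\mathbb{R}^{m\times n}$; (Unbiasedness) $\mathbb{E}_k[\mathbf{G}_k\mid\mathcal{F}_{k-1}]=\nabla f(\mathbf{X}_k)$; and (Bounded variance) $\mathbb{E}_k[\|\mathbf{G}_k-\nabla f(\mathbf{X}_k)\|_F^2\mid\mathcal{F}_{k-1}]\le\sigma^2$, for $k=1,\dots,K$. Let $\gamma\in(0,1]$, $\tau\in(0,1]$, $$\hat\sigma^2=\max\left\{\sigma^2,\frac{L(f(\mathbf{X}_1)-f^* )}{K\gamma^2}\right\},\quad 1-\theta=\sqrt{\frac{L(f(\mathbf{X}_1)-f^* )}{K\hat\sigma^2}},\quad \eta=\sqrt{\frac{\delta^2(f(\mathbf{X}_1)-f^* )}{4LK\hat\sigma^2}},\quad \delta=\frac{\tau\hat\sigma}{\sqrt{m+n}}.$$ Then the iterates of the generalized truncated SPlus algorithm (see context) with these parameters satisfy $$\frac1K\sum_{k=1}^K\mathbb{E}\left[\|\nabla f(\mathbf{X}_k)\|_*\right]\le\left(4+\frac{11}{\tau}\right)\sqrt{m+n}\cdot\sqrt[4]{\frac{\hat\sigma^2L(f(\mathbf{X}_1)-f^* )}{K}}.$$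
   Context: Setting: $f:\mathbb{R}^{m\times n}\to\mathbb{R}$ is differentiable and bounded below, $f(\mathbf{X})=\mathbb{E}_{\zeta\sim\mathcal{P}}[f(\mathbf{X};\zeta)]$, $f^*=\inf_{\mathbf{X}}f(\mathbf{X})$; $L>0$, $\sigma\ge0$ are constants and $K\ge1$ is the number of iterations. $\zeta_1,\zeta_2,\dots$ are the random samples, $\mathbf{G}_k\in\mathbb{R}^{m\times n}$ is the stochastic gradient at $\mathbf{X}_k$ computed from $\zeta_k$, $\mathcal{F}_k=\sigma(\zeta_1,\dots,\zeta_k)$ ($\mathcal{F}_0$ trivial), $\mathbb{E}_k[\cdot\mid\mathcal{F}_{k-1}]$ is conditional expectation over $\zeta_k$ given $\mathcal{F}_{k-1}$, and $\mathbb{E}=\mathbb{E}_{\mathcal{F}_K}$. $\mathbf{X}_1$ is deterministic. $\|\cdot\|_F$ is the Frobenius norm and $\|\cdot\|_*$ the nuclear norm. It is understood that $\hat\sigma>0$, so that the parameter formulas make sense. Generalized truncated SPlus algorithm: given hyperparameters $\eta,\theta,\delta$ and $\mathbf{X}_1$, set $\mathbf{M}_0=\mathbf{0}$, and for $k=1,\dots,K$: obtain $\mathbf{G}_k$; set $\mathbf{M}_k=\theta\mathbf{M}_{k-1}+(1-\theta)\mathbf{G}_k$; choose arbitrary orthogonal matrices $\mathbf{P}_k\in\mathbb{R}^{m\times m}$, $\mathbf{Q}_k\in\mathbb{R}^{n\times n}$, which may depend on the whole history up to and including $\mathbf{G}_k$ (i.e. are $\mathcal{F}_k$-measurable); set $$\mathbf{X}_{k+1}=\mathbf{X}_k-\eta\,\mathbf{P}_k\frac{\mathbf{P}_k^\top\mathbf{M}_k\mathbf{Q}_k}{\max\{|\mathbf{P}_k^\top\mathbf{M}_k\mathbf{Q}_k|,\delta\}}\mathbf{Q}_k^\top,$$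 where absolute value, maximum with $\delta$ and division of matrices are elementwise. *)

theory Defs
  imports "HOL-Probability.Probability"
begin

text \<open>
  The singular values of a real \<open>m \<times> n\<close> matrix \<open>A\<close> are the square roots \<open>s \<ge> 0\<close> of the
  eigenvalues of the symmetric matrix \<open>A\<^sup>T A\<close>; the multiplicity of \<open>s\<close> is the dimension of the
  eigenspace for \<open>s\<^sup>2\<close>.  The Frobenius norm and inner product need no definition: they are
  the \<open>norm\<close> and \<open>inner\<close> of the type \<open>real ^ 'n ^ 'm\<close>, so \<open>GDERIV\<close> gives the matrix gradient.
\<close>

definition singular_space :: "real ^ 'n ^ 'm \<Rightarrow> real \<Rightarrow> (real ^ 'n) set" where
  "singular_space A s = {v. (transpose A ** A) *v v = s\<^sup>2 *\<^sub>R v}"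

definition singular_values :: "real ^ 'n ^ 'm \<Rightarrow> real set" where
  "singular_values A = {s. 0 \<le> s \<and> singular_space A s \<noteq> {0}}"

definition nuclear_norm :: "real ^ 'n ^ 'm \<Rightarrow> real" where
  "nuclear_norm A = (\<Sum>s\<in>singular_values A. real (dim (singular_space A s)) * s)"

text \<open>The index set of this sum is finite, so the sum does not collapse to the default value 0.\<close>

lemma singular_space_orthogonal:
  assumes "v \<in> singular_space A s" "w \<in> singular_space A t" "s\<^sup>2 \<noteq> t\<^sup>2"
  shows "orthogonal v w"
proof -
  let ?B = "transpose A ** A"
  have "(?B *v v) \<bullet> w = v \<bullet> (?B *v w)"
    by (metis dot_lmul_matrix matrix_transpose_mul transpose_matrix_vector transpose_transpose)
  then have "s\<^sup>2 * (v \<bullet> w) = t\<^sup>2 * (v \<bullet> w)"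
    using assms by (simp add: singular_space_def)
  then show ?thesis
    using assms(3) by (simp add: orthogonal_def)
qed

lemma finite_singular_values: "finite (singular_values A)"
proof -
  have "\<forall>s\<in>singular_values A. \<exists>v. v \<in> singular_space A s \<and> v \<noteq> 0"
    by (fastforce simp: singular_values_def singular_space_def)
  then obtain v where v: "\<And>s. s \<in> singular_values A \<Longrightarrow> v s \<in> singular_space A s \<and> v s \<noteq> 0"
    by metis
  have orth: "orthogonal (v s) (v t)"
    if "s \<in> singular_values A" "t \<in> singular_values A" "s \<noteq> t" for s t
    using that v by (intro singular_space_orthogonal[of _ A s _ t])
      (auto simp: singular_values_def power2_eq_iff_nonneg)
  have inj: "inj_on v (singular_values A)"
    using orth v by (metis inj_onI orthogonal_self)
  have "independent (v ` singular_values A)"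
    using orth v by (intro pairwise_orthogonal_independent) (auto simp: pairwise_def)
  then show ?thesis
    using inj finite_imageD independent_imp_finite by blast
qed

text \<open>For \<open>k = 0\<close> the generating family is empty, so the \<open>\<sigma>\<close>-algebra is trivial.\<close>

definition natural_filtration :: "'a measure \<Rightarrow> 'z measure \<Rightarrow> (nat \<Rightarrow> 'a \<Rightarrow> 'z) \<Rightarrow> nat \<Rightarrow> 'a measure"
  where "natural_filtration \<Omega> S \<zeta> k =
    sigma (space \<Omega>) {\<zeta> i -` A \<inter> space \<Omega> | i A. i \<in> {1..k} \<and> A \<in> sets S}"

definition truncated_sign :: "real \<Rightarrow> real ^ 'n ^ 'm \<Rightarrow> real ^ 'n ^ 'm" where
  "truncated_sign \<delta> A = (\<chi> i j. A $ i $ j / max \<bar>A $ i $ j\<bar> \<delta>)"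

text \<open>
  This describes one sample path; the theorem imposes it pointwise on the underlying probability
  space.  The iteration counter runs over \<open>1, \<dots>, K\<close>;
  only \<open>M 0, \<dots>, M K\<close> and \<open>X 1, \<dots>, X (K + 1)\<close> are constrained.
\<close>

definition truncated_splus_run ::
  "real \<Rightarrow> real \<Rightarrow> real \<Rightarrow> nat \<Rightarrow> real ^ 'n ^ 'm \<Rightarrow> (nat \<Rightarrow> real ^ 'n ^ 'm)
    \<Rightarrow> (nat \<Rightarrow> real ^ 'm ^ 'm) \<Rightarrow> (nat \<Rightarrow> real ^ 'n ^ 'n)
    \<Rightarrow> (nat \<Rightarrow> real ^ 'n ^ 'm) \<Rightarrow> (nat \<Rightarrow> real ^ 'n ^ 'm) \<Rightarrow> bool" where
  "truncated_splus_run \<eta> \<theta> \<delta> K X\<^sub>1 G P Q M X \<longleftrightarrow>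
     X 1 = X\<^sub>1 \<and> M 0 = 0 \<and>
     (\<forall>k\<in>{1..K}.
        M k = \<theta> *\<^sub>R M (k - 1) + (1 - \<theta>) *\<^sub>R G k \<and>
        orthogonal_matrix (P k) \<and> orthogonal_matrix (Q k) \<and>
        X (k + 1) = X k - \<eta> *\<^sub>R
          (P k ** truncated_sign \<delta> (transpose (P k) ** M k ** Q k) ** transpose (Q k)))"

end

theory Submission
  imports Defs
begin

text \<open>
  Write \<open>s = 1 - \<theta>\<close>, let \<open>D\<^sub>k\<close> be the update direction, \<open>e\<^sub>k = M\<^sub>k - \<nabla>f(X\<^sub>k)\<close> the momentum error and
  \<open>a\<^sub>k = \<langle>M\<^sub>k, D\<^sub>k\<rangle>\<close>. Elementwise truncation gives \<open>\<delta> \<parallel>D\<^sub>k\<parallel>\<^sup>2 \<le> a\<^sub>k\<close>, without any dependence on \<open>m n\<close>, so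
  smoothness bounds the sum of the \<open>a\<^sub>k\<close> by the initial gap plus the squared errors, and the recursion
  for the expected squared error is driven by the conditional variance and by \<open>a\<^sub>k\<close>. The two bounds
  together yield that the means of \<open>a\<^sub>k\<close> and \<open>\<parallel>e\<^sub>k\<parallel>\<^sup>2\<close> are at most \<open>9 s \<sigma>h\<^sup>2 / \<delta>\<close> and \<open>21/4 s \<sigma>h\<^sup>2\<close>.
  Finally, pairing the gradient with a dual contraction and splitting \<open>P\<^sup>T M Q\<close> into entries above and
  below \<open>\<delta>\<close> bounds its nuclear norm by \<open>a\<^sub>k + \<surd>n (\<parallel>e\<^sub>k\<parallel> + \<surd>(\<delta> a\<^sub>k))\<close>.
\<close>

section \<open>The nuclear norm and its dual\<close>

text \<open>A maximiser \<open>v\<close> of the Rayleigh quotient on the unit sphere of the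
  invariant subspace is an eigenvector; compactness provides it. Used below for
  \<open>transpose A ** A\<close> on an orthogonal complement.\<close>

lemma selfadjoint_eigenvector:
  fixes T :: "'a::euclidean_space \<Rightarrow> 'a"
  assumes lin: "linear T" and selfadj: "\<And>x y. T x \<bullet> y = x \<bullet> T y"
    and S: "subspace S" "T ` S \<subseteq> S" "S \<noteq> {0}"
  obtains v c where "v \<in> S" "v \<noteq> 0" "T v = c *\<^sub>R v"
proof -
  let ?K = "S \<inter> sphere 0 1"
  have "compact ?K"
    using S(1) by (simp add: closed_Int_compact closed_subspace)
  moreover have "?K \<noteq> {}"
  proof -
    obtain x where "x \<in> S" "x \<noteq> 0"
      using S(1,3) subspace_0 by blast
    then have "(1 / norm x) *\<^sub>R x \<in> ?K"
      using S(1) by (auto intro: subspace_scale)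
    then show ?thesis by blast
  qed
  moreover have "continuous_on ?K (\<lambda>x. x \<bullet> T x)"
    using lin by (intro continuous_intros linear_continuous_on) (simp add: linear_conv_bounded_linear)
  ultimately obtain v where v: "v \<in> ?K" and max: "\<And>x. x \<in> ?K \<Longrightarrow> x \<bullet> T x \<le> v \<bullet> T v"
    using continuous_attains_sup[of ?K "\<lambda>x. x \<bullet> T x"] by blast
  define c where "c = v \<bullet> T v"
  define w where "w = c *\<^sub>R v - T v"
  have vS: "v \<in> S" and vv: "v \<bullet> v = 1"
    using v by (auto simp: norm_eq_1)
  have wS: "w \<in> S"
    unfolding w_def using S vS by (intro subspace_diff subspace_scale) auto
  have nonneg: "0 \<le> c * (x \<bullet> x) - x \<bullet> T x" if "x \<in> S" for x
  proof (cases "x = 0")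
    case False
    have "(1 / norm x) *\<^sub>R x \<in> ?K"
      using S(1) that False by (auto intro: subspace_scale)
    from max[OF this] have "(x \<bullet> T x) / (norm x)\<^sup>2 \<le> c"
      using lin by (simp add: linear_scale c_def power2_eq_square)
    then show ?thesis
      using False by (simp add: divide_simps dot_square_norm mult.commute)
  qed (simp add: linear_0[OF lin])
  define q where "q = c * (w \<bullet> w) - w \<bullet> T w"
  have q: "0 \<le> q" using nonneg[OF wS] by (simp add: q_def)
  \<comment> \<open>The form \<open>c * (x \<bullet> x) - x \<bullet> T x\<close> is nonnegative on
    \<open>S\<close> and vanishes at \<open>v\<close>. Moving from \<open>v\<close> along the
    residual \<open>w\<close> changes it to first order by \<open>2 * t * (w \<bullet> w)\<close>,
    which takes both signs unless \<open>w = 0\<close>.\<close>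
  have quad: "0 \<le> 2 * t * (w \<bullet> w) + t\<^sup>2 * q" for t
  proof -
    have "v + t *\<^sub>R w \<in> S" using vS wS S(1) by (intro subspace_add subspace_scale)
    from nonneg[OF this]
    have "0 \<le> c * ((v + t *\<^sub>R w) \<bullet> (v + t *\<^sub>R w)) - (v + t *\<^sub>R w) \<bullet> T (v + t *\<^sub>R w)" .
    also have "\<dots> = 2 * t * (c * (v \<bullet> w) - T v \<bullet> w) + t\<^sup>2 * q"
      using selfadj[of w v] selfadj[of v w]
      by (simp add: linear_add[OF lin] linear_scale[OF lin] q_def c_def vv inner_commute
          algebra_simps power2_eq_square)
    also have "c * (v \<bullet> w) - T v \<bullet> w = w \<bullet> w"
    proof -
      have "T v \<bullet> v = c" by (simp add: c_def inner_commute)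
      then have "v \<bullet> w = 0" by (simp add: w_def inner_diff_right vv inner_commute)
      then show ?thesis
        by (simp add: w_def inner_diff_left inner_commute)
    qed
    finally show ?thesis .
  qed
  have "w \<bullet> w = 0"
  proof (rule ccontr)
    let ?b = "w \<bullet> w"
    assume "?b \<noteq> 0"
    then have b: "0 < ?b" by simp
    \<comment> \<open>A small negative \<open>t\<close> makes the linear term win; the
      \<open>+ 1\<close> in the denominator covers the case \<open>q = 0\<close>.\<close>
    have "2 * (- ?b / (q + 1)) * ?b + (- ?b / (q + 1))\<^sup>2 * q = - (?b\<^sup>2 * (q + 2)) / (q + 1)\<^sup>2"
      using q by (simp add: power2_eq_square divide_simps) (simp add: algebra_simps)
    also have "\<dots> < 0"
      using b q by (intro divide_neg_pos) (auto intro!: mult_pos_pos)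
    finally show False using quad[of "- ?b / (q + 1)"] by linarith
  qed
  then have "T v = c *\<^sub>R v" by (simp add: w_def)
  moreover have "v \<noteq> 0" using vv by auto
  ultimately show thesis using that vS by blast
qed

lemma inner_transpose_mult_vec:
  fixes A :: "real ^ 'n ^ 'm"
  shows "((transpose A ** A) *v x) \<bullet> y = (A *v x) \<bullet> (A *v y)"
  by (metis dot_lmul_matrix matrix_vector_mul_assoc transpose_matrix_vector)

lemma subspace_singular_space: "subspace (singular_space A s)"
  unfolding singular_space_def subspace_def
  by (simp add: matrix_vector_right_distrib scaleR_right_distrib matrix_vector_mult_scaleR)

text \<open>Otherwise the orthogonal complement of the span is nonzero and invariant under
  \<open>transpose A ** A\<close>, so it contains an eigenvector. Its eigenvalue \<open>c\<close> is
  nonnegative, hence the eigenvector lies in the singular space of \<open>sqrt c\<close> and is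
  orthogonal to itself.\<close>

lemma span_singular_spaces: "span (\<Union>s\<in>singular_values A. singular_space A s) = UNIV"
proof (rule ccontr)
  let ?T = "\<lambda>x. (transpose A ** A) *v x"
  let ?U = "\<Union>s\<in>singular_values A. singular_space A s"
  let ?S = "{x. \<forall>v\<in>?U. orthogonal v x}"
  assume "span ?U \<noteq> UNIV"
  then obtain x where x: "x \<notin> span ?U" by blast
  obtain y z where yz: "y \<in> span ?U" "\<And>w. w \<in> span ?U \<Longrightarrow> orthogonal z w" "x = y + z"
    by (metis orthogonal_subspace_decomp_exists)
  have zS: "z \<in> ?S" using yz(2) span_base orthogonal_commute by blast
  have "z \<noteq> 0" using x yz by auto
  have selfadj: "?T x \<bullet> y = x \<bullet> ?T y" for x y
    by (metis inner_commute inner_transpose_mult_vec)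
  have "subspace ?S" by (auto simp: subspace_def orthogonal_def inner_right_distrib)
  moreover have "?T ` ?S \<subseteq> ?S"
  proof -
    have "v \<bullet> ?T x = 0" if "x \<in> ?S" "s \<in> singular_values A" "v \<in> singular_space A s" for x v s
    proof -
      have "v \<bullet> ?T x = ?T v \<bullet> x" using selfadj by simp
      also have "\<dots> = s\<^sup>2 * (v \<bullet> x)" using that(3) by (simp add: singular_space_def)
      also have "v \<bullet> x = 0" using that by (auto simp: orthogonal_def)
      finally show ?thesis by simp
    qed
    then show ?thesis by (auto simp: orthogonal_def)
  qed
  moreover have "?S \<noteq> {0}" using zS \<open>z \<noteq> 0\<close> by blast
  ultimately obtain v c where v: "v \<in> ?S" "v \<noteq> 0" "?T v = c *\<^sub>R v"
    by (rule selfadjoint_eigenvector[OF matrix_vector_mul_linear selfadj]) blast+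
  have "c * (v \<bullet> v) = (A *v v) \<bullet> (A *v v)"
    using v(3) inner_transpose_mult_vec[of A v v] by simp
  then have "0 \<le> c * (v \<bullet> v)" by simp
  moreover have "0 < v \<bullet> v" using v(2) by simp
  ultimately have "0 \<le> c" by (simp add: zero_le_mult_iff)
  then have "v \<in> singular_space A (sqrt c)" using v(3) by (simp add: singular_space_def)
  moreover from this have "sqrt c \<in> singular_values A"
    using v(2) \<open>0 \<le> c\<close> unfolding singular_values_def by auto
  ultimately have "v \<in> ?U" by blast
  then have "orthogonal v v" using v(1) by blast
  then show False using v(2) by (simp add: orthogonal_self)
qed

text \<open>Glueing orthonormal bases of the singular spaces gives right singular vectors. On the
  space of \<open>s\<close> one has
  \<open>(A *v x) \<bullet> (A *v y) = s\<^sup>2 * (x \<bullet> y)\<close>, so images stay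
  orthogonal and each has length \<open>s\<close>; every \<open>s\<close> is counted as often as the
  dimension says. This replaces the singular value decomposition.\<close>

lemma nuclear_norm_orthonormal_basis:
  fixes A :: "real ^ 'n ^ 'm"
  obtains B where "finite B" "pairwise orthogonal B" "\<And>v. v \<in> B \<Longrightarrow> norm v = 1" "span B = UNIV"
    "pairwise (\<lambda>v w. orthogonal (A *v v) (A *v w)) B"
    "nuclear_norm A = (\<Sum>v\<in>B. norm (A *v v))"
proof -
  have "\<exists>B. B \<subseteq> singular_space A s \<and> pairwise orthogonal B \<and> (\<forall>x\<in>B. norm x = 1) \<and>
     independent B \<and> card B = dim (singular_space A s) \<and> span B = singular_space A s" for s
    by (rule orthonormal_basis_subspace[OF subspace_singular_space[of A s]]) blast
  then obtain b where b: "\<And>s. b s \<subseteq> singular_space A s" "\<And>s. pairwise orthogonal (b s)"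
    "\<And>s x. x \<in> b s \<Longrightarrow> norm x = 1" "\<And>s. independent (b s)"
    "\<And>s. card (b s) = dim (singular_space A s)" "\<And>s. span (b s) = singular_space A s"
    by metis
  let ?V = "singular_values A"
  define B where "B = (\<Union>s\<in>?V. b s)"
  have fin: "finite (b s)" for s using b(4) independent_imp_finite by blast
  have finB: "finite B" unfolding B_def using fin finite_singular_values by blast
  have cross: "orthogonal x y" if "s \<in> ?V" "t \<in> ?V" "s \<noteq> t" "x \<in> b s" "y \<in> b t" for s t x y
    using that b(1) by (intro singular_space_orthogonal[of x A s y t])
      (auto simp: singular_values_def power2_eq_iff_nonneg)
  have orthB: "pairwise orthogonal B"
    unfolding pairwise_def
  proof (intro ballI impI)
    fix x y assume "x \<in> B" "y \<in> B" "x \<noteq> y"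
    then obtain s t where st: "s \<in> ?V" "t \<in> ?V" "x \<in> b s" "y \<in> b t" by (auto simp: B_def)
    show "orthogonal x y"
      using cross[OF st(1,2) _ st(3,4)] b(2)[of s] st \<open>x \<noteq> y\<close> by (cases "s = t") (auto simp: pairwise_def)
  qed
  have Axy: "(A *v x) \<bullet> (A *v y) = s\<^sup>2 * (x \<bullet> y)" if "x \<in> b s" for s x y
    using b(1)[of s] that inner_transpose_mult_vec[of A x y] by (auto simp: singular_space_def)
  have norm1: "norm v = 1" if "v \<in> B" for v using that b(3) by (auto simp: B_def)
  have "(\<Union>s\<in>?V. singular_space A s) \<subseteq> span B"
    unfolding B_def by (metis UN_least UN_upper b(6) span_mono)
  then have "span B = UNIV"
    using span_singular_spaces[of A] by (metis span_minimal subspace_span top.extremum_uniqueI)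
  moreover have "pairwise (\<lambda>v w. orthogonal (A *v v) (A *v w)) B"
    using orthB Axy unfolding pairwise_def B_def orthogonal_def by fastforce
  moreover have "nuclear_norm A = (\<Sum>v\<in>B. norm (A *v v))"
  proof -
    have disj: "b s \<inter> b t = {}" if "s \<in> ?V" "t \<in> ?V" "s \<noteq> t" for s t
    proof (rule ccontr)
      assume "b s \<inter> b t \<noteq> {}"
      then obtain x where "x \<in> b s" "x \<in> b t" by blast
      with cross[OF that] have "x = 0" by (metis orthogonal_self)
      with b(3)[OF \<open>x \<in> b s\<close>] show False by simp
    qed
    have "norm (A *v v) = s" if "s \<in> ?V" "v \<in> b s" for s v
    proof -
      have "(norm (A *v v))\<^sup>2 = s\<^sup>2" using Axy[of v s v] b(3)[of v s] that
        by (simp add: dot_square_norm)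
      then show ?thesis using that(1) by (simp add: singular_values_def power2_eq_iff_nonneg)
    qed
    then have "(\<Sum>v\<in>B. norm (A *v v)) = (\<Sum>s\<in>?V. \<Sum>v\<in>b s. s)"
      unfolding B_def using fin finite_singular_values disj
      by (subst sum.UNION_disjoint) (auto intro!: sum.cong)
    then show ?thesis by (simp add: nuclear_norm_def b(5))
  qed
  ultimately show thesis using that finB orthB norm1 by blast
qed

text \<open>Parseval's identity for each row. It allows the Frobenius inner product to be evaluated
  in the right singular basis of \<open>A\<close>.\<close>

lemma inner_matrix_orthonormal_basis:
  fixes A W :: "real ^ 'n ^ 'm"
  assumes B: "finite B" "pairwise orthogonal B" "\<And>v. v \<in> B \<Longrightarrow> norm v = 1" "span B = UNIV"
  shows "A \<bullet> W = (\<Sum>v\<in>B. (A *v v) \<bullet> (W *v v))"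
proof -
  have row: "x \<bullet> y = (\<Sum>v\<in>B. (x \<bullet> v) * (y \<bullet> v))" for x y :: "real ^ 'n"
  proof -
    have "x \<bullet> y = (\<Sum>v\<in>B. (x \<bullet> v) *\<^sub>R v) \<bullet> y"
      using orthonormal_basis_expand[OF B(2,3) _ B(1), of x] B(4) by simp
    then show ?thesis by (simp add: inner_sum_left inner_commute[of y])
  qed
  have "A \<bullet> W = (\<Sum>i\<in>UNIV. \<Sum>v\<in>B. (A $ i \<bullet> v) * (W $ i \<bullet> v))"
    unfolding inner_vec_def[of A W] by (intro sum.cong refl row)
  also have "\<dots> = (\<Sum>v\<in>B. \<Sum>i\<in>UNIV. (A $ i \<bullet> v) * (W $ i \<bullet> v))"
    by (rule sum.swap)
  also have "\<dots> = (\<Sum>v\<in>B. (A *v v) \<bullet> (W *v v))"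
    by (simp add: inner_vec_def[of "A *v _" "W *v _"] matrix_vector_mul_component)
  finally show ?thesis .
qed

text \<open>The unit ball of the spectral norm. The nuclear norm is the dual norm: the largest value
  of \<open>A \<bullet> W\<close> over this ball, by the two lemmas that follow.\<close>

definition contraction :: "real ^ 'n ^ 'm \<Rightarrow> bool" where
  "contraction W \<longleftrightarrow> (\<forall>x. norm (W *v x) \<le> norm x)"

lemma inner_contraction_le_nuclear_norm:
  assumes "contraction W"
  shows "A \<bullet> W \<le> nuclear_norm A"
proof -
  obtain B where B: "finite B" "pairwise orthogonal B" "\<And>v. v \<in> B \<Longrightarrow> norm v = 1" "span B = UNIV"
    and nn: "nuclear_norm A = (\<Sum>v\<in>B. norm (A *v v))"
    by (rule nuclear_norm_orthonormal_basis[of A]) (rule that)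
  have "(A *v v) \<bullet> (W *v v) \<le> norm (A *v v)" if "v \<in> B" for v
  proof -
    have "(A *v v) \<bullet> (W *v v) \<le> norm (A *v v) * norm (W *v v)" by (rule norm_cauchy_schwarz)
    also have "\<dots> \<le> norm (A *v v) * 1"
      using assms B(3)[OF that] unfolding contraction_def by (intro mult_left_mono) (metis, simp)
    finally show ?thesis by simp
  qed
  then have "(\<Sum>v\<in>B. (A *v v) \<bullet> (W *v v)) \<le> nuclear_norm A"
    unfolding nn by (rule sum_mono)
  then show ?thesis
    using inner_matrix_orthonormal_basis[OF B, of A W] by simp
qed

text \<open>The witness \<open>W\<close> is the polar factor of \<open>A\<close>: it sends each
  right singular vector to the normalised image under \<open>A\<close>.\<close>

lemma nuclear_norm_attained:
  fixes A :: "real ^ 'n ^ 'm"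
  obtains W where "contraction W" "nuclear_norm A = A \<bullet> W"
proof -
  obtain B where B: "finite B" "pairwise orthogonal B" "\<And>v. v \<in> B \<Longrightarrow> norm v = 1" "span B = UNIV"
    and orth: "pairwise (\<lambda>v w. orthogonal (A *v v) (A *v w)) B"
    and nn: "nuclear_norm A = (\<Sum>v\<in>B. norm (A *v v))"
    by (rule nuclear_norm_orthonormal_basis[of A]) (rule that)
  \<comment> \<open>For \<open>v\<close> in the kernel of \<open>A\<close> the division by zero
    gives \<open>u v = 0\<close>. Thus \<open>W\<close> is a partial isometry, and
    \<open>u v\<close> has norm at most 1 rather than exactly 1.\<close>
  define u where "u v = (1 / norm (A *v v)) *\<^sub>R (A *v v)" for v
  define F where "F x = (\<Sum>v\<in>B. (x \<bullet> v) *\<^sub>R u v)" for x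
  have "linear F"
    unfolding F_def by (intro linear_compose_sum ballI linearI)
      (simp_all add: inner_add_left scaleR_add_left)
  define W where "W = matrix F"
  have W: "W *v x = F x" for x
    unfolding W_def using \<open>linear F\<close> by (simp add: matrix_works)
  have unorm: "norm (u v) \<le> 1" for v by (simp add: u_def)
  have uorth: "u v \<bullet> u w = 0" if "v \<in> B" "w \<in> B" "v \<noteq> w" for v w
    using orth that by (simp add: u_def pairwise_def orthogonal_def)
  have exp: "(\<Sum>v\<in>B. (x \<bullet> v) *\<^sub>R v) = x" for x
    using orthonormal_basis_expand[OF B(2,3) _ B(1), of x] B(4) by simp
  have "norm (W *v x) \<le> norm x" for x
  proof (rule power2_le_imp_le)
    have "(norm (W *v x))\<^sup>2 = (\<Sum>v\<in>B. (norm ((x \<bullet> v) *\<^sub>R u v))\<^sup>2)"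
      unfolding W F_def using uorth B(1)
      by (intro norm_sum_Pythagorean) (auto simp: pairwise_def orthogonal_def)
    also have "\<dots> \<le> (\<Sum>v\<in>B. (x \<bullet> v)\<^sup>2)"
      using unorm by (intro sum_mono) (simp add: power_mult_distrib mult_left_le power_le_one)
    also have "\<dots> = (\<Sum>v\<in>B. (norm ((x \<bullet> v) *\<^sub>R v))\<^sup>2)"
      using B(3) by (intro sum.cong) auto
    also have "\<dots> = (norm (\<Sum>v\<in>B. (x \<bullet> v) *\<^sub>R v))\<^sup>2"
      using B(1,2) by (intro norm_sum_Pythagorean[symmetric]) (auto simp: pairwise_def orthogonal_def)
    also have "\<dots> = (norm x)\<^sup>2" by (simp add: exp)
    finally show "(norm (W *v x))\<^sup>2 \<le> (norm x)\<^sup>2" .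
  qed simp
  moreover have "nuclear_norm A = A \<bullet> W"
  proof -
    have "F v = u v" if "v \<in> B" for v
    proof -
      have "F v = (\<Sum>w\<in>B. if w = v then u v else 0)"
        unfolding F_def using B(2,3) that
        by (intro sum.cong) (auto simp: pairwise_def orthogonal_def dot_square_norm)
      then show ?thesis using that B(1) by simp
    qed
    then have "norm (A *v v) = (A *v v) \<bullet> (W *v v)" if "v \<in> B" for v
      using that by (simp add: W u_def dot_square_norm power2_eq_square)
    then have "nuclear_norm A = (\<Sum>v\<in>B. (A *v v) \<bullet> (W *v v))"
      unfolding nn by (rule sum.cong[OF refl])
    then show ?thesis
      using inner_matrix_orthonormal_basis[OF B, of A W] by simp
  qed
  ultimately show thesis by (intro that[of W]) (simp_all add: contraction_def)
qed

lemma contraction_entry_le_1: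
  assumes "contraction W"
  shows "\<bar>W $ i $ j\<bar> \<le> 1"
proof -
  have "\<bar>W $ i $ j\<bar> \<le> norm (W *v axis j 1)"
    using component_le_norm_cart[of "W *v axis j 1" i]
    by (simp add: matrix_vector_mult_basis column_def)
  also have "\<dots> \<le> 1"
    using assms unfolding contraction_def by (metis norm_axis_1)
  finally show ?thesis .
qed

lemma norm_matrix_sum_columns:
  fixes W :: "real ^ 'n ^ 'm"
  shows "(norm W)\<^sup>2 = (\<Sum>j\<in>UNIV. (norm (W *v axis j 1))\<^sup>2)"
proof -
  have "(norm W)\<^sup>2 = (\<Sum>i\<in>UNIV. \<Sum>j\<in>UNIV. (W $ i $ j)\<^sup>2)"
    by (simp add: norm_eq_sqrt_inner inner_vec_def power2_eq_square sum_nonneg)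
  also have "\<dots> = (\<Sum>j\<in>UNIV. \<Sum>i\<in>UNIV. (W $ i $ j)\<^sup>2)"
    by (rule sum.swap)
  also have "\<dots> = (\<Sum>j\<in>UNIV. (norm (W *v axis j 1))\<^sup>2)"
    by (simp add: norm_eq_sqrt_inner inner_vec_def power2_eq_square sum_nonneg
        matrix_vector_mult_basis column_def)
  finally show ?thesis .
qed

text \<open>Each of the \<open>n\<close> columns is the image of a unit vector. The resulting
  \<open>sqrt n\<close> is later relaxed to \<open>sqrt (m + n)\<close>.\<close>

lemma norm_contraction_le:
  fixes W :: "real ^ 'n ^ 'm"
  assumes "contraction W"
  shows "norm W \<le> sqrt (real CARD('n))"
proof (rule real_le_rsqrt)
  have "(norm (W *v axis j 1))\<^sup>2 \<le> 1" for j
    using assms unfolding contraction_def by (metis norm_axis_1 norm_ge_zero power_le_one)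
  then show "(norm W)\<^sup>2 \<le> real CARD('n)"
    unfolding norm_matrix_sum_columns using sum_mono[of UNIV "\<lambda>j. (norm (W *v axis j 1))\<^sup>2" "\<lambda>_. 1"]
    by simp
qed

lemma inner_contraction_le_norm:
  fixes A W :: "real ^ 'n ^ 'm"
  assumes "contraction W"
  shows "A \<bullet> W \<le> sqrt (real CARD('n)) * norm A"
proof -
  have "A \<bullet> W \<le> norm A * norm W" by (rule norm_cauchy_schwarz)
  also have "\<dots> \<le> norm A * sqrt (real CARD('n))"
    using norm_contraction_le[OF assms] by (intro mult_left_mono) auto
  finally show ?thesis by (simp add: mult.commute)
qed

lemma nuclear_norm_nonneg: "0 \<le> nuclear_norm A"
  unfolding nuclear_norm_def by (intro sum_nonneg) (auto simp: singular_values_def)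

lemma nuclear_norm_le_norm:
  fixes A :: "real ^ 'n ^ 'm"
  shows "nuclear_norm A \<le> sqrt (real CARD('n)) * norm A"
  by (metis inner_contraction_le_norm nuclear_norm_attained)

lemma nuclear_norm_zero: "nuclear_norm (0 :: real ^ 'n ^ 'm) = 0"
  using nuclear_norm_le_norm[of "0 :: real ^ 'n ^ 'm"] nuclear_norm_nonneg[of "0 :: real ^ 'n ^ 'm"] by simp

text \<open>The contraction that attains the norm of one matrix is a test matrix for the other. The
  Lipschitz bound is there to make the nuclear norm continuous, hence Borel measurable.\<close>

lemma nuclear_norm_diff_le:
  fixes A B :: "real ^ 'n ^ 'm"
  shows "\<bar>nuclear_norm A - nuclear_norm B\<bar> \<le> sqrt (real CARD('n)) * norm (A - B)"
proof -
  have "nuclear_norm A - nuclear_norm B \<le> sqrt (real CARD('n)) * norm (A - B)"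
    for A B :: "real ^ 'n ^ 'm"
  proof -
    obtain W where W: "contraction W" "nuclear_norm A = A \<bullet> W" by (rule nuclear_norm_attained)
    have "A \<bullet> W = B \<bullet> W + (A - B) \<bullet> W" by (simp add: inner_diff_left)
    then show ?thesis
      using inner_contraction_le_nuclear_norm[OF W(1), of B] inner_contraction_le_norm[OF W(1), of "A - B"] W(2)
      by linarith
  qed
  from this[of A B] this[of B A] show ?thesis by (simp add: abs_le_iff norm_minus_commute)
qed

lemma continuous_on_nuclear_norm: "continuous_on UNIV (nuclear_norm :: real ^ 'n ^ 'm \<Rightarrow> real)"
proof -
  have "(sqrt (real CARD('n)))-lipschitz_on UNIV (nuclear_norm :: real ^ 'n ^ 'm \<Rightarrow> real)"
    using nuclear_norm_diff_le by (intro lipschitz_onI) (auto simp: dist_norm)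
  then show ?thesis by (rule lipschitz_on_continuous_on)
qed

section \<open>The truncated sign\<close>

lemma inner_matrix_trace:
  fixes A W :: "real ^ 'n ^ 'm"
  shows "A \<bullet> W = trace (transpose A ** W)"
  unfolding inner_vec_def trace_def matrix_matrix_mult_def transpose_def
  by (simp add: sum.swap[of _ "UNIV :: 'm set" "UNIV :: 'n set"])

lemma inner_matrix_mult_left:
  fixes P :: "real ^ 'k ^ 'm" and A :: "real ^ 'n ^ 'k"
  shows "(P ** A) \<bullet> W = A \<bullet> (transpose P ** W)"
  by (simp add: inner_matrix_trace matrix_transpose_mul matrix_mul_assoc)

lemma inner_matrix_mult_right:
  fixes A :: "real ^ 'k ^ 'm" and R :: "real ^ 'n ^ 'k"
  shows "(A ** R) \<bullet> W = A \<bullet> (W ** transpose R)"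
  using trace_mul_sym[of "transpose R" "transpose A ** W"]
  by (simp add: inner_matrix_trace matrix_transpose_mul matrix_mul_assoc)

text \<open>Moves the two rotations to the other factor, so that inner products with the update are
  computed in the coordinates of \<open>transpose P ** M ** Q\<close>, where truncation acts
  entrywise.\<close>

lemma inner_matrix_conj:
  fixes T W :: "real ^ 'n ^ 'm"
  shows "(P ** T ** transpose Q) \<bullet> W = T \<bullet> (transpose P ** W ** Q)"
proof -
  have "(P ** T ** transpose Q) \<bullet> W = (P ** T) \<bullet> (W ** Q)"
    using inner_matrix_mult_right[of "P ** T" "transpose Q" W] by simp
  also have "\<dots> = T \<bullet> (transpose P ** W ** Q)"
    by (simp add: inner_matrix_mult_left matrix_mul_assoc)
  finally show ?thesis .
qed

lemma norm_orthogonal_matrix_mult_vec: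
  fixes P :: "real ^ 'n ^ 'n"
  assumes "orthogonal_matrix P"
  shows "norm (P *v x) = norm x"
  using inner_transpose_mult_vec[of P x x] assms
  by (simp add: norm_eq orthogonal_matrix_def)

lemma contraction_orthogonal_conj:
  assumes "contraction W" "orthogonal_matrix P" "orthogonal_matrix Q"
  shows "contraction (transpose P ** W ** Q)"
proof -
  have "norm (transpose P *v (W *v (Q *v x))) \<le> norm x" for x
    using assms norm_orthogonal_matrix_mult_vec[of "transpose P"]
    by (metis contraction_def norm_orthogonal_matrix_mult_vec orthogonal_matrix_transpose)
  then show ?thesis by (simp add: contraction_def matrix_vector_mul_assoc[symmetric])
qed

lemma norm_orthogonal_conj:
  fixes T :: "real ^ 'n ^ 'm"
  assumes "orthogonal_matrix P" "orthogonal_matrix Q"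
  shows "norm (P ** T ** transpose Q) = norm T"
proof -
  have "transpose P ** (P ** T ** transpose Q) ** Q = (transpose P ** P) ** T ** (transpose Q ** Q)"
    by (simp add: matrix_mul_assoc)
  then show ?thesis using assms by (simp add: norm_eq inner_matrix_conj orthogonal_matrix_def)
qed

lemma inner_matrix_sum: "(A :: real ^ 'n ^ 'm) \<bullet> B = (\<Sum>i\<in>UNIV. \<Sum>j\<in>UNIV. A $ i $ j * B $ i $ j)"
  by (simp add: inner_vec_def)

lemma norm_matrix_sum: "(norm (A :: real ^ 'n ^ 'm))\<^sup>2 = (\<Sum>i\<in>UNIV. \<Sum>j\<in>UNIV. (A $ i $ j)\<^sup>2)"
  unfolding power2_norm_eq_inner inner_matrix_sum by (simp add: power2_eq_square)

text \<open>Entrywise, \<open>t = x / max \<bar>x\<bar> \<delta>\<close> satisfies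
  \<open>x * t = max \<bar>x\<bar> \<delta> * t\<^sup>2\<close>, which is at least
  \<open>\<delta> * t\<^sup>2\<close>. So the inner product pays for the squared step length without
  a dimension factor.\<close>

lemma norm_truncated_sign_square_le:
  assumes "\<delta> > 0"
  shows "\<delta> * (norm (truncated_sign \<delta> A))\<^sup>2 \<le> A \<bullet> truncated_sign \<delta> A"
proof -
  have "\<delta> * (x / max \<bar>x\<bar> \<delta>)\<^sup>2 \<le> x * (x / max \<bar>x\<bar> \<delta>)" for x :: real
  proof -
    have "\<delta> * (x / max \<bar>x\<bar> \<delta>)\<^sup>2 = (\<delta> / max \<bar>x\<bar> \<delta>) * (x * (x / max \<bar>x\<bar> \<delta>))"
      by (simp add: power2_eq_square)
    also have "\<dots> \<le> 1 * (x * (x / max \<bar>x\<bar> \<delta>))"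
      using assms by (intro mult_right_mono) (auto simp: max_def)
    finally show ?thesis by simp
  qed
  then show ?thesis
    unfolding norm_matrix_sum inner_matrix_sum sum_distrib_left
    by (intro sum_mono) (simp add: truncated_sign_def)
qed

text \<open>All entries have absolute value at most 1. This crude bound serves integrability only
  and does not enter the rate.\<close>

lemma norm_truncated_sign_le:
  fixes A :: "real ^ 'n ^ 'm"
  assumes "\<delta> > 0"
  shows "norm (truncated_sign \<delta> A) \<le> sqrt (real CARD('m) * real CARD('n))"
proof (rule real_le_rsqrt)
  have "\<bar>x / (max \<bar>x\<bar> \<delta>)\<bar> \<le> 1" for x :: real
    using assms by (auto simp: max_def)
  then have "(x / max \<bar>x\<bar> \<delta>)\<^sup>2 \<le> 1" for x :: real
    by (simp only: abs_square_le_1)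
  then have "(norm (truncated_sign \<delta> A))\<^sup>2 \<le> (\<Sum>i\<in>(UNIV :: 'm set). \<Sum>j\<in>(UNIV :: 'n set). 1)"
    unfolding norm_matrix_sum by (intro sum_mono) (simp add: truncated_sign_def)
  then show "(norm (truncated_sign \<delta> A))\<^sup>2 \<le> real CARD('m) * real CARD('n)" by simp
qed

text \<open>
  The entries of size at least \<open>\<delta>\<close> are paid for by their absolute values, which the inner product
  with the truncated sign collects in full; the other entries are paid for in Frobenius norm, of
  which that inner product collects the square divided by \<open>\<delta>\<close>.
\<close>

lemma inner_contraction_le_truncated_sign:
  fixes A W :: "real ^ 'n ^ 'm"
  assumes "\<delta> > 0" "contraction W"
  defines "a \<equiv> A \<bullet> truncated_sign \<delta> A"
  shows "A \<bullet> W \<le> a + sqrt (real CARD('n)) * sqrt (\<delta> * a)"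
proof -
  define B C :: "real ^ 'n ^ 'm"
    where "B = (\<chi> i j. if \<delta> \<le> \<bar>A $ i $ j\<bar> then A $ i $ j else 0)"
      and "C = (\<chi> i j. if \<delta> \<le> \<bar>A $ i $ j\<bar> then 0 else A $ i $ j)"
  have AB: "A = B + C" by (simp add: B_def C_def vec_eq_iff)
  have BT: "B $ i $ j * W $ i $ j \<le> A $ i $ j * truncated_sign \<delta> A $ i $ j" for i j
  proof (cases "\<delta> \<le> \<bar>A $ i $ j\<bar>")
    case True
    have "A $ i $ j * W $ i $ j \<le> \<bar>A $ i $ j\<bar> * \<bar>W $ i $ j\<bar>"
      by (metis abs_ge_self abs_mult)
    also have "\<dots> \<le> \<bar>A $ i $ j\<bar>"
      using contraction_entry_le_1[OF assms(2), of i j] by (simp add: mult_left_le)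
    also have "\<dots> = A $ i $ j * truncated_sign \<delta> A $ i $ j"
      using True assms(1) by (simp add: truncated_sign_def max_def abs_if)
    finally show ?thesis using True by (simp add: B_def)
  next
    case False
    then show ?thesis using assms(1) by (simp add: B_def truncated_sign_def)
  qed
  have CT: "(C $ i $ j)\<^sup>2 \<le> \<delta> * (A $ i $ j * truncated_sign \<delta> A $ i $ j)" for i j
    using assms(1) by (auto simp: C_def truncated_sign_def power2_eq_square max_def)
  have "B \<bullet> W \<le> a"
    unfolding a_def inner_matrix_sum by (intro sum_mono BT)
  moreover have "(norm C)\<^sup>2 \<le> \<delta> * a"
    unfolding a_def norm_matrix_sum inner_matrix_sum sum_distrib_left by (intro sum_mono CT)
  then have "sqrt (real CARD('n)) * norm C \<le> sqrt (real CARD('n)) * sqrt (\<delta> * a)"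
    by (intro mult_left_mono real_le_rsqrt) auto
  moreover have "A \<bullet> W = B \<bullet> W + C \<bullet> W" by (simp add: AB inner_add_left)
  ultimately show ?thesis
    using inner_contraction_le_norm[OF assms(2), of C] by linarith
qed

definition splus_direction ::
  "real \<Rightarrow> real ^ 'm ^ 'm \<Rightarrow> real ^ 'n ^ 'n \<Rightarrow> real ^ 'n ^ 'm \<Rightarrow> real ^ 'n ^ 'm" where
  "splus_direction \<delta> P Q M = P ** truncated_sign \<delta> (transpose P ** M ** Q) ** transpose Q"

lemma inner_splus_direction:
  "M \<bullet> splus_direction \<delta> P Q M
    = (transpose P ** M ** Q) \<bullet> truncated_sign \<delta> (transpose P ** M ** Q)"
  by (simp add: splus_direction_def inner_commute[of M] inner_matrix_conj)
     (rule inner_commute)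

lemma norm_splus_direction:
  assumes "orthogonal_matrix P" "orthogonal_matrix Q"
  shows "norm (splus_direction \<delta> P Q M) = norm (truncated_sign \<delta> (transpose P ** M ** Q))"
  using assms by (simp add: splus_direction_def norm_orthogonal_conj)

lemma norm_splus_direction_square_le:
  assumes "\<delta> > 0" "orthogonal_matrix P" "orthogonal_matrix Q"
  shows "\<delta> * (norm (splus_direction \<delta> P Q M))\<^sup>2 \<le> M \<bullet> splus_direction \<delta> P Q M"
  unfolding inner_splus_direction norm_splus_direction[OF assms(2,3)]
  by (rule norm_truncated_sign_square_le[OF assms(1)])

lemma norm_splus_direction_le:
  fixes M :: "real ^ 'n ^ 'm"
  assumes "\<delta> > 0" "orthogonal_matrix P" "orthogonal_matrix Q"
  shows "norm (splus_direction \<delta> P Q M) \<le> sqrt (real CARD('m) * real CARD('n))"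
  unfolding norm_splus_direction[OF assms(2,3)]
  by (rule norm_truncated_sign_le[OF assms(1)])

text \<open>Let \<open>W\<close> be dual to \<open>g\<close>, not to \<open>M\<close>, and split
  \<open>g \<bullet> W = M \<bullet> W + (g - M) \<bullet> W\<close>. The first term is rotated into
  the coordinates of the truncation, where the rotated \<open>W\<close> is still a contraction; this
  is why arbitrary orthogonal \<open>P\<close> and \<open>Q\<close> are allowed. The second term
  costs the momentum error.\<close>

lemma nuclear_norm_le_splus_direction:
  fixes M g :: "real ^ 'n ^ 'm"
  assumes "\<delta> > 0" "orthogonal_matrix P" "orthogonal_matrix Q"
  defines "a \<equiv> M \<bullet> splus_direction \<delta> P Q M"
  shows "nuclear_norm g \<le> a + sqrt (real CARD('n)) * (norm (M - g) + sqrt (\<delta> * a))"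
proof -
  obtain W where W: "contraction W" "nuclear_norm g = g \<bullet> W" by (rule nuclear_norm_attained)
  let ?A = "transpose P ** M ** Q"
  have "M = P ** ?A ** transpose Q"
  proof -
    have "P ** ?A ** transpose Q = (P ** transpose P) ** M ** (Q ** transpose Q)"
      by (simp add: matrix_mul_assoc)
    then show ?thesis using assms(2,3) by (simp add: orthogonal_matrix_def)
  qed
  then have "M \<bullet> W = (P ** ?A ** transpose Q) \<bullet> W" by simp
  also have "\<dots> = ?A \<bullet> (transpose P ** W ** Q)"
    by (rule inner_matrix_conj)
  also have "\<dots> \<le> a + sqrt (real CARD('n)) * sqrt (\<delta> * a)"
    unfolding a_def inner_splus_direction
    by (intro inner_contraction_le_truncated_sign contraction_orthogonal_conj assms W)
  finally have "M \<bullet> W \<le> a + sqrt (real CARD('n)) * sqrt (\<delta> * a)" .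
  moreover have "(g - M) \<bullet> W \<le> sqrt (real CARD('n)) * norm (M - g)"
    using inner_contraction_le_norm[OF W(1), of "g - M"] by (simp add: norm_minus_commute)
  ultimately show ?thesis
    by (simp add: W(2) inner_diff_left algebra_simps)
qed

section \<open>Continuity and measurability of the update direction\<close>

lemma continuous_on_matrix_mult [continuous_intros]:
  fixes A :: "'a::topological_space \<Rightarrow> real ^ 'k ^ 'm" and B :: "'a \<Rightarrow> real ^ 'n ^ 'k"
  assumes "continuous_on S A" "continuous_on S B"
  shows "continuous_on S (\<lambda>x. A x ** B x)"
  unfolding matrix_matrix_mult_def using assms by (intro continuous_intros)

lemma continuous_on_transpose [continuous_intros]:
  fixes A :: "'a::topological_space \<Rightarrow> real ^ 'n ^ 'm"
  assumes "continuous_on S A"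
  shows "continuous_on S (\<lambda>x. transpose (A x))"
  unfolding transpose_def using assms by (intro continuous_intros)

lemma continuous_on_truncated_sign [continuous_intros]:
  fixes A :: "'a::topological_space \<Rightarrow> real ^ 'n ^ 'm"
  assumes "\<delta> > 0" "continuous_on S A"
  shows "continuous_on S (\<lambda>x. truncated_sign \<delta> (A x))"
  unfolding truncated_sign_def using assms by (intro continuous_intros) auto

text \<open>All denominators are at least \<open>\<delta> > 0\<close>, so the direction depends
  continuously on the triple of matrices. The \<sigma>-algebra \<open>F\<close> is left general so
  that it can be a member of the filtration.\<close>

lemma measurable_splus_direction:
  fixes P :: "'a \<Rightarrow> real ^ 'm ^ 'm" and Q :: "'a \<Rightarrow> real ^ 'n ^ 'n"
  assumes "\<delta> > 0"
    and [measurable]: "P \<in> borel_measurable F" "Q \<in> borel_measurable F" "M \<in> borel_measurable F"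
  shows "(\<lambda>\<omega>. splus_direction \<delta> (P \<omega>) (Q \<omega>) (M \<omega>)) \<in> borel_measurable F"
proof -
  have "continuous_on UNIV (\<lambda>((P, Q), M). splus_direction \<delta> P Q (M :: real ^ 'n ^ 'm))"
    unfolding splus_direction_def case_prod_unfold using assms(1) by (intro continuous_intros)
  then have c: "(\<lambda>((P, Q), M). splus_direction \<delta> P Q (M :: real ^ 'n ^ 'm)) \<in> borel_measurable borel"
    by (rule borel_measurable_continuous_onI)
  have p: "(\<lambda>\<omega>. ((P \<omega>, Q \<omega>), M \<omega>)) \<in> F \<rightarrow>\<^sub>M borel"
    by (intro borel_measurable_Pair assms)
  show ?thesis using measurable_compose[OF p c] by simp
qed

section \<open>Smooth functions and momentum\<close>

text \<open>Along the segment from \<open>x\<close> to \<open>y\<close>, the difference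
  \<open>h\<close> between \<open>f\<close> and the quadratic upper model has nonpositive
  derivative. Monotonicity of \<open>h\<close> replaces integration of the gradient.\<close>

lemma descent_lemma:
  fixes f :: "'a::real_inner \<Rightarrow> real"
  assumes grad: "\<And>x. GDERIV f x :> grad x"
    and smooth: "\<And>x y. norm (grad y - grad x) \<le> L * norm (y - x)"
  shows "f y \<le> f x + grad x \<bullet> (y - x) + L / 2 * (norm (y - x))\<^sup>2"
proof -
  let ?d = "y - x"
  define h where "h t = f (x + t *\<^sub>R ?d) - t * (grad x \<bullet> ?d) - t\<^sup>2 * (L / 2 * (norm ?d)\<^sup>2)" for t
  have "h 1 \<le> h 0"
  proof (rule DERIV_nonpos_imp_nonincreasing[where f = h])
    fix t :: real assume t: "0 \<le> t" "t \<le> 1"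
    have "((\<lambda>t. f (x + t *\<^sub>R ?d)) has_derivative (\<lambda>s. (s *\<^sub>R ?d) \<bullet> grad (x + t *\<^sub>R ?d))) (at t)"
      using grad[of "x + t *\<^sub>R ?d"] unfolding gderiv_def
      by (intro has_derivative_compose[where g = f and f = "\<lambda>t. x + t *\<^sub>R ?d"])
        (auto intro!: derivative_eq_intros)
    then have "DERIV (\<lambda>t. f (x + t *\<^sub>R ?d)) t :> grad (x + t *\<^sub>R ?d) \<bullet> ?d"
      unfolding has_field_derivative_def
      by (rule has_derivative_eq_rhs) (simp add: fun_eq_iff inner_commute mult.commute)
    then have "DERIV h t :> grad (x + t *\<^sub>R ?d) \<bullet> ?d - grad x \<bullet> ?d - 2 * t * (L / 2 * (norm ?d)\<^sup>2)"
      unfolding h_def by (auto intro!: derivative_eq_intros)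
    moreover have "grad (x + t *\<^sub>R ?d) \<bullet> ?d - grad x \<bullet> ?d \<le> 2 * t * (L / 2 * (norm ?d)\<^sup>2)"
    proof -
      have "(grad (x + t *\<^sub>R ?d) - grad x) \<bullet> ?d \<le> norm (grad (x + t *\<^sub>R ?d) - grad x) * norm ?d"
        by (rule norm_cauchy_schwarz)
      also have "\<dots> \<le> (L * norm (t *\<^sub>R ?d)) * norm ?d"
        using smooth[where x = x and y = "x + t *\<^sub>R ?d"] by (intro mult_right_mono) auto
      finally show ?thesis using t by (simp add: inner_diff_left power2_eq_square ac_simps)
    qed
    ultimately show "\<exists>y. DERIV h t :> y \<and> y \<le> 0" by force
  qed simp
  then show ?thesis by (simp add: h_def)
qed

text \<open>A gradient step with step size \<open>1 / L\<close> lowers \<open>f\<close> by at least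
  the squared gradient norm over \<open>2 * L\<close>, but cannot go below \<open>b\<close>. It
  bounds the initial momentum error, which comes from the gradient at the starting point.\<close>

lemma norm_gradient_square_le:
  fixes f :: "'a::real_inner \<Rightarrow> real"
  assumes "\<And>x. GDERIV f x :> grad x"
    and "\<And>x y. norm (grad y - grad x) \<le> L * norm (y - x)"
    and "L > 0" and lower: "\<And>x. b \<le> f x"
  shows "(norm (grad x))\<^sup>2 \<le> 2 * L * (f x - b)"
proof -
  let ?y = "x - (1 / L) *\<^sub>R grad x"
  have "b \<le> f ?y" by (rule lower)
  also have "\<dots> \<le> f x + grad x \<bullet> (?y - x) + L / 2 * (norm (?y - x))\<^sup>2"
    using assms(1,2) by (rule descent_lemma)
  also have "\<dots> = f x - (norm (grad x))\<^sup>2 / (2 * L)"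
    using assms(3) by (simp add: dot_square_norm power2_eq_square field_simps)
  finally show ?thesis using assms(3) by (simp add: field_simps)
qed

text \<open>The previous bound with \<open>b = f x\<close>; it settles the degenerate case of a zero
  initial gap.\<close>

lemma gradient_at_minimum:
  fixes f :: "'a::real_inner \<Rightarrow> real"
  assumes "\<And>x. GDERIV f x :> grad x"
    and "\<And>x y. norm (grad y - grad x) \<le> L * norm (y - x)"
    and "L > 0" and "\<And>y. f x \<le> f y"
  shows "grad x = 0"
  using norm_gradient_square_le[of f grad L "f x" x] assms by simp

text \<open>Young's inequality with the weight \<open>4/3\<close>, which is what makes the final constants fit.\<close>

lemma momentum_step_descent:
  fixes f :: "'a::real_inner \<Rightarrow> real"
  assumes grad: "\<And>x. GDERIV f x :> grad x"
    and smooth: "\<And>x y. norm (grad y - grad x) \<le> L * norm (y - x)"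
    and "L > 0" "\<delta> > 0" "s > 0" and eta: "\<eta> = \<delta> * s / (2 * L)"
    and d: "\<delta> * (norm d)\<^sup>2 \<le> m \<bullet> d"
  shows "(5 / 8 - s / 4) * (m \<bullet> d)
    \<le> (f x - f (x - \<eta> *\<^sub>R d)) / \<eta> + 2 / (3 * \<delta>) * (norm (m - grad x))\<^sup>2"
proof -
  let ?e = "norm (m - grad x)" and ?n = "norm d"
  have eta_pos: "\<eta> > 0" using assms by simp
  have "f (x - \<eta> *\<^sub>R d) \<le> f x + grad x \<bullet> (x - \<eta> *\<^sub>R d - x) + L / 2 * (norm (x - \<eta> *\<^sub>R d - x))\<^sup>2"
    using grad smooth by (rule descent_lemma)
  \<comment> \<open>The step size gives
    \<open>L / 2 * \<eta>\<^sup>2 = \<eta> * (s / 4) * \<delta>\<close>, so the quadratic term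
    becomes a multiple of \<open>\<delta> * ?n\<^sup>2\<close>, the quantity that \<open>d\<close>
    bounds by \<open>m \<bullet> d\<close>.\<close>
  also have "\<dots> = f x - \<eta> * (grad x \<bullet> d - s / 4 * (\<delta> * ?n\<^sup>2))"
    using assms(3) by (simp add: power_mult_distrib algebra_simps) (simp add: eta power2_eq_square)
  finally have "\<eta> * (grad x \<bullet> d - s / 4 * (\<delta> * ?n\<^sup>2)) \<le> f x - f (x - \<eta> *\<^sub>R d)" by simp
  then have "grad x \<bullet> d - s / 4 * (\<delta> * ?n\<^sup>2) \<le> (f x - f (x - \<eta> *\<^sub>R d)) / \<eta>"
    using eta_pos by (simp add: pos_le_divide_eq mult.commute)
  moreover have "m \<bullet> d - grad x \<bullet> d \<le> 2 / (3 * \<delta>) * ?e\<^sup>2 + 3 / 8 * (\<delta> * ?n\<^sup>2)"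
  proof -
    have "0 \<le> (4 * ?e - 3 * \<delta> * ?n)\<^sup>2 / (24 * \<delta>)" using assms(4) by simp
    also have "\<dots> = 2 / (3 * \<delta>) * ?e\<^sup>2 + 3 / 8 * (\<delta> * ?n\<^sup>2) - ?e * ?n"
      using assms(4) by (simp add: power2_eq_square field_simps)
    finally show ?thesis
      using norm_cauchy_schwarz[of "m - grad x" d] by (simp add: inner_diff_left)
  qed
  moreover have "s / 4 * (\<delta> * ?n\<^sup>2) \<le> s / 4 * (m \<bullet> d)"
    using d assms(5) by (intro mult_left_mono) auto
  \<comment> \<open>Both multiples of \<open>\<delta> * ?n\<^sup>2\<close> are absorbed into
    \<open>m \<bullet> d\<close>, which leaves the coefficient
    \<open>1 - 3 / 8 - s / 4\<close>.\<close>
  ultimately have "m \<bullet> d - s / 4 * (m \<bullet> d) - 3 / 8 * (m \<bullet> d)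
      \<le> (f x - f (x - \<eta> *\<^sub>R d)) / \<eta> + 2 / (3 * \<delta>) * ?e\<^sup>2"
    using d by linarith
  then show ?thesis by (simp add: algebra_simps)
qed

text \<open>When the gradient moves from \<open>g\<close> to \<open>g'\<close>, Young's inequality
  worsens the contraction factor only from \<open>(1 - s)\<^sup>2\<close> to \<open>1 - s\<close>.
  The squared drift is of order \<open>s\<^sup>2 * \<delta>\<close> times
  \<open>\<delta> * (norm d)\<^sup>2\<close>, so it is paid for by
  \<open>m \<bullet> d\<close>.\<close>

lemma momentum_error_drift:
  fixes m g g' d :: "'a::real_inner"
  assumes "0 < s" "s \<le> 1" "\<delta> > 0"
    and d: "\<delta> * (norm d)\<^sup>2 \<le> m \<bullet> d"
    and drift: "norm (g' - g) \<le> \<delta> * s / 2 * norm d"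
  shows "(1 - s)\<^sup>2 * (norm (m - g'))\<^sup>2
    \<le> (1 - s) * (norm (m - g))\<^sup>2 + (1 - s)\<^sup>2 * s * \<delta> / 4 * (m \<bullet> d)"
proof -
  define e where "e = m - g"
  define r where "r = g - g'"
  let ?t = "1 - s"
  have "(norm r)\<^sup>2 \<le> (\<delta> * s / 2 * norm d)\<^sup>2"
    using drift by (intro power_mono) (auto simp: r_def norm_minus_commute)
  also have "\<dots> = s\<^sup>2 * \<delta> / 4 * (\<delta> * (norm d)\<^sup>2)" by (simp add: power2_eq_square)
  also have "\<dots> \<le> s\<^sup>2 * \<delta> / 4 * (m \<bullet> d)" using assms(3) d by (intro mult_left_mono) auto
  finally have r: "(norm r)\<^sup>2 \<le> s\<^sup>2 * \<delta> / 4 * (m \<bullet> d)" .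
  \<comment> \<open>Expanding this square is Young's inequality with weights
    \<open>1 / (1 - s)\<close> and \<open>1 / s\<close>, written without division by
    \<open>1 - s\<close>, so that \<open>s = 1\<close> is covered.\<close>
  have "0 \<le> (norm (s *\<^sub>R e - ?t *\<^sub>R r))\<^sup>2" by simp
  also have "\<dots> = s * ((norm e)\<^sup>2 - ?t * (norm (e + r))\<^sup>2) + ?t * (norm r)\<^sup>2"
    unfolding power2_norm_eq_inner
    by (simp add: inner_diff_left inner_diff_right inner_commute[of r e] algebra_simps)
  finally have "?t * (norm (e + r))\<^sup>2 \<le> (norm e)\<^sup>2 + ?t / s * (norm r)\<^sup>2"
    using assms(1) by (simp add: field_simps)
  also have "\<dots> \<le> (norm e)\<^sup>2 + ?t / s * (s\<^sup>2 * \<delta> / 4 * (m \<bullet> d))"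
    using r assms(1,2) by (intro add_left_mono mult_left_mono) auto
  also have "\<dots> = (norm e)\<^sup>2 + ?t * s * \<delta> / 4 * (m \<bullet> d)"
    using assms(1) by (simp add: power2_eq_square)
  finally have "?t * (?t * (norm (e + r))\<^sup>2) \<le> ?t * ((norm e)\<^sup>2 + ?t * s * \<delta> / 4 * (m \<bullet> d))"
    using assms(2) by (intro mult_left_mono) auto
  then show ?thesis by (simp add: e_def r_def power2_eq_square algebra_simps)
qed

section \<open>Square-integrable random matrices\<close>

definition square_integrable :: "'a measure \<Rightarrow> ('a \<Rightarrow> 'b::euclidean_space) \<Rightarrow> bool" where
  "square_integrable M h \<longleftrightarrow> h \<in> borel_measurable M \<and> integrable M (\<lambda>x. (norm (h x))\<^sup>2)"

text \<open>The recursions of the algorithm are imposed only on \<open>space \<Omega>\<close>, so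
  replacing \<open>M\<close> by its recursion needs a congruence restricted to the sample
  space.\<close>

lemma square_integrable_cong:
  "(\<And>\<omega>. \<omega> \<in> space N \<Longrightarrow> h \<omega> = h' \<omega>) \<Longrightarrow> square_integrable N h \<longleftrightarrow> square_integrable N h'"
  unfolding square_integrable_def
  by (intro conj_cong measurable_cong Bochner_Integration.integrable_cong) auto

lemma square_integrable_scaleR:
  "square_integrable M h \<Longrightarrow> square_integrable M (\<lambda>x. c *\<^sub>R h x)"
  unfolding square_integrable_def by (auto simp: power_mult_distrib)

lemma square_integrable_add:
  assumes "square_integrable M h" "square_integrable M k"
  shows "square_integrable M (\<lambda>x. h x + k x)"
proof -
  have [measurable]: "h \<in> borel_measurable M" "k \<in> borel_measurable M"
    and int: "integrable M (\<lambda>x. (norm (h x))\<^sup>2)" "integrable M (\<lambda>x. (norm (k x))\<^sup>2)"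
    using assms by (auto simp: square_integrable_def)
  have le: "(norm (a + b))\<^sup>2 \<le> 2 * (norm a)\<^sup>2 + 2 * (norm b)\<^sup>2" for a b :: 'b
    using zero_le_power2[of "norm (a - b)"] unfolding power2_norm_eq_inner
    by (simp add: inner_diff_left inner_diff_right inner_add inner_commute[of b a])
  have "integrable M (\<lambda>x. (norm (h x + k x))\<^sup>2)"
  proof (rule Bochner_Integration.integrable_bound)
    show "integrable M (\<lambda>x. 2 * (norm (h x))\<^sup>2 + 2 * (norm (k x))\<^sup>2)"
      using int by simp
    show "AE x in M. norm ((norm (h x + k x))\<^sup>2) \<le> norm (2 * (norm (h x))\<^sup>2 + 2 * (norm (k x))\<^sup>2)"
      using le by (intro AE_I2) simp
  qed measurable
  then show ?thesis by (simp add: square_integrable_def)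
qed

lemma square_integrable_diff:
  "square_integrable M h \<Longrightarrow> square_integrable M k \<Longrightarrow> square_integrable M (\<lambda>x. h x - k x)"
  using square_integrable_add[of M h "\<lambda>x. (- 1) *\<^sub>R k x"] square_integrable_scaleR[of M k "- 1"]
  by simp

lemma integrable_inner:
  assumes "square_integrable M h" "square_integrable M k"
  shows "integrable M (\<lambda>x. h x \<bullet> k x)"
proof -
  have [measurable]: "h \<in> borel_measurable M" "k \<in> borel_measurable M"
    and int: "integrable M (\<lambda>x. (norm (h x))\<^sup>2)" "integrable M (\<lambda>x. (norm (k x))\<^sup>2)"
    using assms by (auto simp: square_integrable_def)
  have le: "\<bar>a \<bullet> b\<bar> \<le> (norm a)\<^sup>2 + (norm b)\<^sup>2" for a b :: 'b
    using Cauchy_Schwarz_ineq2[of a b] sum_squares_bound[of "norm a" "norm b"]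
      mult_nonneg_nonneg[OF norm_ge_zero[of a] norm_ge_zero[of b]] by linarith
  show ?thesis
  proof (rule Bochner_Integration.integrable_bound)
    show "integrable M (\<lambda>x. (norm (h x))\<^sup>2 + (norm (k x))\<^sup>2)"
      using int by simp
    show "AE x in M. norm (h x \<bullet> k x) \<le> norm ((norm (h x))\<^sup>2 + (norm (k x))\<^sup>2)"
      using le by (intro AE_I2) simp
  qed measurable
qed

lemma (in finite_measure) square_integrable_bounded:
  assumes "h \<in> borel_measurable M" "\<And>x. x \<in> space M \<Longrightarrow> norm (h x) \<le> c"
  shows "square_integrable M h"
  unfolding square_integrable_def using assms
  by (auto intro!: integrable_const_bound[where B = "c\<^sup>2"] power_mono AE_I2)

lemma borel_measurable_matrix_entry [measurable (raw)]:
  fixes U :: "'a \<Rightarrow> real ^ 'n ^ 'm"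
  assumes [measurable]: "U \<in> borel_measurable M"
  shows "(\<lambda>\<omega>. U \<omega> $ i $ j) \<in> borel_measurable M"
proof -
  have "U \<omega> $ i $ j = U \<omega> \<bullet> axis i (axis j 1)" for \<omega>
    by (simp add: inner_axis)
  then show ?thesis by simp
qed

lemma square_integrable_matrix_entry:
  fixes U :: "'a \<Rightarrow> real ^ 'n ^ 'm"
  assumes "square_integrable M U"
  shows "square_integrable M (\<lambda>\<omega>. U \<omega> $ i $ j)"
proof -
  have [measurable]: "U \<in> borel_measurable M" and int: "integrable M (\<lambda>x. (norm (U x))\<^sup>2)"
    using assms by (auto simp: square_integrable_def)
  have "\<bar>A $ i $ j\<bar> \<le> norm A" for A :: "real ^ 'n ^ 'm"
    using component_le_norm_cart[of "A $ i" j] Finite_Cartesian_Product.norm_nth_le[of A i] by linarith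
  then have le: "(A $ i $ j)\<^sup>2 \<le> (norm A)\<^sup>2" for A :: "real ^ 'n ^ 'm"
    by (metis abs_le_square_iff abs_norm_cancel)
  have "integrable M (\<lambda>x. (U x $ i $ j)\<^sup>2)"
  proof (rule Bochner_Integration.integrable_bound[OF int])
    show "AE x in M. norm ((U x $ i $ j)\<^sup>2) \<le> norm ((norm (U x))\<^sup>2)"
      using le by (intro AE_I2) simp
  qed measurable
  then show ?thesis by (simp add: square_integrable_def)
qed

text \<open>Whatever is known from the past is orthogonal in mean square to the centred noise. The
  proof goes entry by entry because unbiasedness is expressed by real-valued conditional
  expectations; square integrability makes every product integrable, so the
  \<open>F\<close>-measurable factor can be pulled out.\<close>

lemma (in finite_measure_subalgebra) integral_inner_cond_exp_error:
  fixes U G H :: "'a \<Rightarrow> real ^ 'n ^ 'm"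
  assumes U: "U \<in> borel_measurable F" "square_integrable M U"
    and GH: "square_integrable M G" "square_integrable M H"
    and ce: "AE \<omega> in M. \<forall>i j. real_cond_exp M F (\<lambda>\<omega>. G \<omega> $ i $ j) \<omega> = H \<omega> $ i $ j"
  shows "(\<integral>\<omega>. U \<omega> \<bullet> (G \<omega> - H \<omega>) \<partial>M) = 0"
proof -
  note entry = square_integrable_matrix_entry
  have int: "integrable M (\<lambda>\<omega>. U \<omega> $ i $ j * G \<omega> $ i $ j)"
    "integrable M (\<lambda>\<omega>. U \<omega> $ i $ j * H \<omega> $ i $ j)" for i j
    using integrable_inner[OF entry[OF U(2)] entry[OF GH(1)], of i j i j]
      integrable_inner[OF entry[OF U(2)] entry[OF GH(2)], of i j i j] by simp_all
  have [measurable]: "U \<in> borel_measurable M" "G \<in> borel_measurable M" "H \<in> borel_measurable M"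
    using U GH by (auto simp: square_integrable_def)
  have [measurable]: "real_cond_exp M F h \<in> borel_measurable M" for h
    by (rule borel_measurable_cond_exp2)
  have entry_eq: "(\<integral>\<omega>. U \<omega> $ i $ j * G \<omega> $ i $ j \<partial>M) = (\<integral>\<omega>. U \<omega> $ i $ j * H \<omega> $ i $ j \<partial>M)" for i j
  proof -
    have "(\<integral>\<omega>. U \<omega> $ i $ j * G \<omega> $ i $ j \<partial>M)
        = (\<integral>\<omega>. U \<omega> $ i $ j * real_cond_exp M F (\<lambda>\<omega>. G \<omega> $ i $ j) \<omega> \<partial>M)"
      by (rule real_cond_exp_intg(2)[OF int(1) borel_measurable_matrix_entry[OF U(1)], symmetric])
        measurable
    also have "\<dots> = (\<integral>\<omega>. U \<omega> $ i $ j * H \<omega> $ i $ j \<partial>M)"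
    proof (rule integral_cong_AE)
      show "AE \<omega> in M. U \<omega> $ i $ j * real_cond_exp M F (\<lambda>\<omega>. G \<omega> $ i $ j) \<omega> = U \<omega> $ i $ j * H \<omega> $ i $ j"
        using ce by eventually_elim simp
    qed measurable
    finally show ?thesis .
  qed
  have "(\<integral>\<omega>. U \<omega> \<bullet> (G \<omega> - H \<omega>) \<partial>M)
      = (\<integral>\<omega>. (\<Sum>i\<in>UNIV. \<Sum>j\<in>UNIV. U \<omega> $ i $ j * G \<omega> $ i $ j - U \<omega> $ i $ j * H \<omega> $ i $ j) \<partial>M)"
    by (simp add: inner_matrix_sum right_diff_distrib)
  also have "\<dots> = (\<Sum>i\<in>UNIV. \<Sum>j\<in>UNIV.
      (\<integral>\<omega>. U \<omega> $ i $ j * G \<omega> $ i $ j \<partial>M) - (\<integral>\<omega>. U \<omega> $ i $ j * H \<omega> $ i $ j \<partial>M))"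
    using int by (simp add: Bochner_Integration.integral_sum)
  also have "\<dots> = 0" by (simp add: entry_eq)
  finally show ?thesis .
qed

text \<open>The nonnegative conditional expectation is meaningful before integrability is known.
  Integrating it therefore yields integrability of \<open>h\<close> and the bound on its mean at
  once.\<close>

lemma (in finite_measure_subalgebra) integral_le_of_nn_cond_exp_le:
  assumes [measurable]: "h \<in> borel_measurable M" and nonneg: "\<And>x. 0 \<le> h x"
    and "emeasure M (space M) = 1" "0 \<le> c"
    and bound: "AE x in M. nn_cond_exp M F (\<lambda>x. ennreal (h x)) x \<le> ennreal c"
  shows "integrable M h" "(\<integral>x. h x \<partial>M) \<le> c"
proof -
  have "(\<integral>\<^sup>+ x. ennreal (h x) \<partial>M) = (\<integral>\<^sup>+ x. nn_cond_exp M F (\<lambda>x. ennreal (h x)) x \<partial>M)"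
    using nn_cond_exp_intg[of "\<lambda>_. 1" "\<lambda>x. ennreal (h x)"] by simp
  also have "\<dots> \<le> (\<integral>\<^sup>+ x. ennreal c \<partial>M)" using bound by (rule nn_integral_mono_AE)
  also have "\<dots> = ennreal c" by (simp add: assms(3))
  finally have le: "(\<integral>\<^sup>+ x. ennreal (h x) \<partial>M) \<le> ennreal c" .
  then have "(\<integral>\<^sup>+ x. ennreal (h x) \<partial>M) < \<infinity>" by (simp add: order_le_less_trans)
  then show int: "integrable M h"
    using nonneg by (intro integrableI_nonneg) auto
  have "ennreal (\<integral>x. h x \<partial>M) \<le> ennreal c"
    using le nn_integral_eq_integral[OF int] nonneg by simp
  then show "(\<integral>x. h x \<partial>M) \<le> c" using assms(4) by (simp add: ennreal_le_iff)
qed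

section \<open>The natural filtration of the samples\<close>

lemma space_natural_filtration: "space (natural_filtration \<Omega> D \<zeta> k) = space \<Omega>"
  unfolding natural_filtration_def by (auto intro!: space_measure_of)

lemma sets_natural_filtration:
  "sets (natural_filtration \<Omega> D \<zeta> k)
    = sigma_sets (space \<Omega>) {\<zeta> i -` A \<inter> space \<Omega> | i A. i \<in> {1..k} \<and> A \<in> sets D}"
  unfolding natural_filtration_def by (auto intro!: sets_measure_of)

lemma subalgebra_natural_filtration:
  assumes "\<And>i. i \<in> {1..k} \<Longrightarrow> \<zeta> i \<in> \<Omega> \<rightarrow>\<^sub>M D"
  shows "subalgebra \<Omega> (natural_filtration \<Omega> D \<zeta> k)"
  unfolding subalgebra_def space_natural_filtration sets_natural_filtration
  using assms by (auto intro!: sets.sigma_sets_subset measurable_sets)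

lemma subalgebra_natural_filtration_mono:
  assumes "j \<le> k"
  shows "subalgebra (natural_filtration \<Omega> D \<zeta> k) (natural_filtration \<Omega> D \<zeta> j)"
  unfolding subalgebra_def space_natural_filtration sets_natural_filtration
  using assms by (intro conjI refl sigma_sets_mono') fastforce

lemma measurable_natural_filtration:
  assumes "i \<in> {1..k}" "\<zeta> i \<in> \<Omega> \<rightarrow>\<^sub>M D"
  shows "\<zeta> i \<in> natural_filtration \<Omega> D \<zeta> k \<rightarrow>\<^sub>M D"
proof (rule measurableI)
  show "\<zeta> i \<omega> \<in> space D" if "\<omega> \<in> space (natural_filtration \<Omega> D \<zeta> k)" for \<omega>
    using that measurable_space[OF assms(2)] by (simp add: space_natural_filtration)
  show "\<zeta> i -` A \<inter> space (natural_filtration \<Omega> D \<zeta> k) \<in> sets (natural_filtration \<Omega> D \<zeta> k)"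
    if "A \<in> sets D" for A
    unfolding space_natural_filtration sets_natural_filtration
    using that assms(1) by (intro sigma_sets.Basic) auto
qed

lemma norm_square_combination:
  fixes u v :: "'a::real_inner"
  shows "(norm (p *\<^sub>R u + q *\<^sub>R v))\<^sup>2 = p\<^sup>2 * (norm u)\<^sup>2 + 2 * p * q * (u \<bullet> v) + q\<^sup>2 * (norm v)\<^sup>2"
  unfolding power2_norm_eq_inner
  by (simp add: inner_add_left inner_add_right inner_commute[of v u] power2_eq_square algebra_simps)

section \<open>The stochastic process\<close>

text \<open>The setting in the parameters that the analysis works with: \<open>s\<close> is
  \<open>1 - \<theta>\<close>, \<open>b\<close> is a lower bound of \<open>f\<close>, and
  \<open>\<eta>\<close> is expressed through \<open>\<delta>\<close> and \<open>s\<close>. The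
  strict \<open>0 < s\<close> permits division by \<open>s\<close> and \<open>\<eta>\<close>; the
  case \<open>s = 0\<close> is settled separately in the theorem.\<close>

locale splus_process = prob_space \<Omega> for \<Omega> :: "'a measure" +
  fixes D :: "'z measure" and \<zeta> :: "nat \<Rightarrow> 'a \<Rightarrow> 'z"
    and g :: "nat \<Rightarrow> real ^ 'n ^ 'm \<Rightarrow> 'z \<Rightarrow> real ^ 'n ^ 'm"
    and G M X :: "nat \<Rightarrow> 'a \<Rightarrow> real ^ 'n ^ 'm"
    and P :: "nat \<Rightarrow> 'a \<Rightarrow> real ^ 'm ^ 'm" and Q :: "nat \<Rightarrow> 'a \<Rightarrow> real ^ 'n ^ 'n"
    and f :: "real ^ 'n ^ 'm \<Rightarrow> real" and grad :: "real ^ 'n ^ 'm \<Rightarrow> real ^ 'n ^ 'm"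
    and X\<^sub>1 :: "real ^ 'n ^ 'm" and K :: nat and L \<sigma> \<eta> s \<delta> b :: real
  assumes \<zeta>: "\<And>k. k \<in> {1..K} \<Longrightarrow> \<zeta> k \<in> \<Omega> \<rightarrow>\<^sub>M D"
    and g: "\<And>k. k \<in> {1..K} \<Longrightarrow> (\<lambda>(Y, z). g k Y z) \<in> borel_measurable (borel \<Otimes>\<^sub>M D)"
    and G: "\<And>k \<omega>. k \<in> {1..K} \<Longrightarrow> \<omega> \<in> space \<Omega> \<Longrightarrow> G k \<omega> = g k (X k \<omega>) (\<zeta> k \<omega>)"
    and P: "\<And>k. k \<in> {1..K} \<Longrightarrow> P k \<in> borel_measurable (natural_filtration \<Omega> D \<zeta> k)"
    and Q: "\<And>k. k \<in> {1..K} \<Longrightarrow> Q k \<in> borel_measurable (natural_filtration \<Omega> D \<zeta> k)"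
    and run: "\<And>\<omega>. \<omega> \<in> space \<Omega> \<Longrightarrow> truncated_splus_run \<eta> (1 - s) \<delta> K X\<^sub>1
          (\<lambda>k. G k \<omega>) (\<lambda>k. P k \<omega>) (\<lambda>k. Q k \<omega>) (\<lambda>k. M k \<omega>) (\<lambda>k. X k \<omega>)"
    and gderiv: "\<And>Y. GDERIV f Y :> grad Y"
    and lower: "\<And>Y. b \<le> f Y"
    and smooth: "\<And>Y Z. norm (grad Z - grad Y) \<le> L * norm (Z - Y)"
    and unbiased: "\<And>k. k \<in> {1..K} \<Longrightarrow> AE \<omega> in \<Omega>. \<forall>i j.
          real_cond_exp \<Omega> (natural_filtration \<Omega> D \<zeta> (k - 1)) (\<lambda>\<omega>. G k \<omega> $ i $ j) \<omega>
            = grad (X k \<omega>) $ i $ j"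
    and bounded_variance: "\<And>k. k \<in> {1..K} \<Longrightarrow> AE \<omega> in \<Omega>.
          nn_cond_exp \<Omega> (natural_filtration \<Omega> D \<zeta> (k - 1))
            (\<lambda>\<omega>. ennreal ((norm (G k \<omega> - grad (X k \<omega>)))\<^sup>2)) \<omega> \<le> ennreal (\<sigma>\<^sup>2)"
    and L_pos: "0 < L" and \<delta>_pos: "0 < \<delta>" and s: "0 < s" "s \<le> 1"
    and \<eta>: "\<eta> = \<delta> * s / (2 * L)"
begin

abbreviation "\<F> \<equiv> natural_filtration \<Omega> D \<zeta>"

definition "dir k \<omega> = splus_direction \<delta> (P k \<omega>) (Q k \<omega>) (M k \<omega>)"

lemma
  assumes "\<omega> \<in> space \<Omega>"
  shows X_1: "X 1 \<omega> = X\<^sub>1" and M_0: "M 0 \<omega> = 0"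
  using run[OF assms] by (auto simp: truncated_splus_run_def)

lemma
  assumes "\<omega> \<in> space \<Omega>" "k \<in> {1..K}"
  shows M_step: "M k \<omega> = (1 - s) *\<^sub>R M (k - 1) \<omega> + s *\<^sub>R G k \<omega>"
    and X_step: "X (k + 1) \<omega> = X k \<omega> - \<eta> *\<^sub>R dir k \<omega>"
    and orthogonal_P: "orthogonal_matrix (P k \<omega>)" and orthogonal_Q: "orthogonal_matrix (Q k \<omega>)"
  using run[OF assms(1)] assms(2) by (auto simp: truncated_splus_run_def dir_def splus_direction_def)

lemma \<eta>_pos: "0 < \<eta>"
  using L_pos \<delta>_pos s by (simp add: \<eta>)

lemma norm_dir_square_le:
  "\<omega> \<in> space \<Omega> \<Longrightarrow> k \<in> {1..K} \<Longrightarrow> \<delta> * (norm (dir k \<omega>))\<^sup>2 \<le> M k \<omega> \<bullet> dir k \<omega>"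
  unfolding dir_def by (intro norm_splus_direction_square_le \<delta>_pos orthogonal_P orthogonal_Q)

lemma norm_dir_le:
  "\<omega> \<in> space \<Omega> \<Longrightarrow> k \<in> {1..K} \<Longrightarrow> norm (dir k \<omega>) \<le> sqrt (real CARD('m) * real CARD('n))"
  unfolding dir_def by (intro norm_splus_direction_le \<delta>_pos orthogonal_P orthogonal_Q)

lemma inner_dir_nonneg: "\<omega> \<in> space \<Omega> \<Longrightarrow> k \<in> {1..K} \<Longrightarrow> 0 \<le> M k \<omega> \<bullet> dir k \<omega>"
  using norm_dir_square_le \<delta>_pos by (meson less_imp_le mult_nonneg_nonneg order_trans zero_le_power2)

section \<open>Adaptedness of the iterates\<close>

lemma borel_measurable_grad [measurable]: "grad \<in> borel_measurable borel"
proof -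
  have "L-lipschitz_on UNIV grad"
    using smooth L_pos by (intro lipschitz_onI) (auto simp: dist_norm)
  then show ?thesis
    by (intro borel_measurable_continuous_onI lipschitz_on_continuous_on)
qed

text \<open>The sample \<open>\<zeta> k\<close> enters at time \<open>k\<close>, after
  \<open>X k\<close> is fixed. So \<open>X k\<close> belongs to time \<open>k - 1\<close>, while
  \<open>G k\<close>, \<open>M k\<close> and the direction belong to time \<open>k\<close>; this
  shift is what makes the noise at step \<open>k\<close> centred given the past.\<close>

lemma measurable_step:
  assumes k: "k \<in> {1..K}" and M: "M (k - 1) \<in> borel_measurable (\<F> (k - 1))"
    and X: "X k \<in> borel_measurable (\<F> (k - 1))"
  shows "G k \<in> borel_measurable (\<F> k)" "M k \<in> borel_measurable (\<F> k)"
    "dir k \<in> borel_measurable (\<F> k)" "X (k + 1) \<in> borel_measurable (\<F> k)"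
proof -
  note space = space_natural_filtration
  have sub: "subalgebra (\<F> k) (\<F> (k - 1))"
    by (rule subalgebra_natural_filtration_mono) simp
  have [measurable]: "M (k - 1) \<in> borel_measurable (\<F> k)" "X k \<in> borel_measurable (\<F> k)"
    using measurable_from_subalg[OF sub] M X by auto
  have [measurable]: "\<zeta> k \<in> \<F> k \<rightarrow>\<^sub>M D"
    using \<zeta>[OF k] k by (intro measurable_natural_filtration) auto
  have "(\<lambda>\<omega>. g k (X k \<omega>) (\<zeta> k \<omega>)) \<in> borel_measurable (\<F> k)"
    using measurable_compose[OF _ g[OF k], of "\<lambda>\<omega>. (X k \<omega>, \<zeta> k \<omega>)" "\<F> k"] by simp
  then show G_meas [measurable]: "G k \<in> borel_measurable (\<F> k)"
    using measurable_cong[of "\<F> k" "G k" "\<lambda>\<omega>. g k (X k \<omega>) (\<zeta> k \<omega>)" borel] G[OF k]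
    by (simp add: space)
  have "(\<lambda>\<omega>. (1 - s) *\<^sub>R M (k - 1) \<omega> + s *\<^sub>R G k \<omega>) \<in> borel_measurable (\<F> k)"
    by measurable
  then show M_meas: "M k \<in> borel_measurable (\<F> k)"
    using measurable_cong[of "\<F> k" "M k"] M_step[OF _ k] by (simp add: space)
  show dir_meas [measurable]: "dir k \<in> borel_measurable (\<F> k)"
    unfolding dir_def[abs_def] by (intro measurable_splus_direction \<delta>_pos P Q k M_meas)
  have "(\<lambda>\<omega>. X k \<omega> - \<eta> *\<^sub>R dir k \<omega>) \<in> borel_measurable (\<F> k)"
    by measurable
  then show "X (k + 1) \<in> borel_measurable (\<F> k)"
    using measurable_cong[of "\<F> k" "X (k + 1)"] X_step[OF _ k] by (simp add: space)
qed

lemma measurable_M_X: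
  "k \<le> K \<Longrightarrow> M k \<in> borel_measurable (\<F> k) \<and> X (k + 1) \<in> borel_measurable (\<F> k)"
proof (induction k)
  case 0
  note space = space_natural_filtration
  \<comment> \<open>\<open>\<F> 0\<close> is trivial, so the base case rests on \<open>M 0\<close>
    and \<open>X 1\<close> being constant on the sample space.\<close>
  have "M 0 \<in> borel_measurable (\<F> 0) \<longleftrightarrow> (\<lambda>\<omega>. 0 :: real ^ 'n ^ 'm) \<in> borel_measurable (\<F> 0)"
    by (intro measurable_cong) (simp add: space M_0)
  moreover have "X 1 \<in> borel_measurable (\<F> 0) \<longleftrightarrow> (\<lambda>\<omega>. X\<^sub>1) \<in> borel_measurable (\<F> 0)"
    using X_1 by (intro measurable_cong) (simp add: space)
  ultimately show ?case by simp
next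
  case (Suc k)
  then show ?case using measurable_step[of "Suc k"] by simp
qed

lemma
  assumes "k \<in> {1..K}"
  shows measurable_prev: "M (k - 1) \<in> borel_measurable (\<F> (k - 1))"
      "X k \<in> borel_measurable (\<F> (k - 1))"
    and subalgebra_prev: "subalgebra \<Omega> (\<F> (k - 1))"
    and finite_measure_subalgebra_prev: "finite_measure_subalgebra \<Omega> (\<F> (k - 1))"
proof -
  show "M (k - 1) \<in> borel_measurable (\<F> (k - 1))" "X k \<in> borel_measurable (\<F> (k - 1))"
    using measurable_M_X[of "k - 1"] assms by auto
  show sub: "subalgebra \<Omega> (\<F> (k - 1))"
    using assms by (intro subalgebra_natural_filtration \<zeta>) auto
  show "finite_measure_subalgebra \<Omega> (\<F> (k - 1))"
    by (intro finite_measure_subalgebra.intro finite_measure_subalgebra_axioms.intro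
        finite_measure_axioms sub)
qed

lemma
  assumes "k \<in> {1..K}"
  shows measurable_G: "G k \<in> borel_measurable \<Omega>" and measurable_dir: "dir k \<in> borel_measurable \<Omega>"
    and measurable_X: "X k \<in> borel_measurable \<Omega>"
proof -
  have sub: "subalgebra \<Omega> (\<F> k)"
    using assms by (intro subalgebra_natural_filtration \<zeta>) auto
  show "G k \<in> borel_measurable \<Omega>" "dir k \<in> borel_measurable \<Omega>"
    using measurable_from_subalg[OF sub] measurable_step[OF assms measurable_prev[OF assms]] by simp_all
  show "X k \<in> borel_measurable \<Omega>"
    using measurable_from_subalg[OF subalgebra_prev[OF assms]] measurable_prev[OF assms] by simp
qed

text \<open>Steps have bounded length, so each iterate stays in a deterministic ball around the
  start. Hence gradients at the iterates are bounded and integrable; the radius does not enter the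
  rate.\<close>

lemma norm_X_le:
  assumes "\<omega> \<in> space \<Omega>"
  shows "k \<le> K \<Longrightarrow> norm (X (Suc k) \<omega> - X\<^sub>1) \<le> real k * (\<eta> * sqrt (real CARD('m) * real CARD('n)))"
proof (induction k)
  case 0
  then show ?case using X_1[OF assms] by simp
next
  case (Suc k)
  have "norm (X (Suc (Suc k)) \<omega> - X\<^sub>1) \<le> norm (X (Suc k) \<omega> - X\<^sub>1) + norm (\<eta> *\<^sub>R dir (Suc k) \<omega>)"
  proof -
    have "X (Suc (Suc k)) \<omega> - X\<^sub>1 = (X (Suc k) \<omega> - X\<^sub>1) - \<eta> *\<^sub>R dir (Suc k) \<omega>"
      using X_step[OF assms, of "Suc k"] Suc.prems by simp
    then show ?thesis by (metis norm_triangle_ineq4)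
  qed
  moreover have "norm (\<eta> *\<^sub>R dir (Suc k) \<omega>) \<le> \<eta> * sqrt (real CARD('m) * real CARD('n))"
    using norm_dir_le[OF assms, of "Suc k"] Suc.prems \<eta>_pos by simp
  ultimately show ?case using Suc by (simp add: algebra_simps)
qed

lemma norm_grad_X_bounded:
  assumes "k \<le> K"
  obtains c where "\<And>\<omega>. \<omega> \<in> space \<Omega> \<Longrightarrow> norm (grad (X (Suc k) \<omega>)) \<le> c"
proof -
  let ?r = "real k * (\<eta> * sqrt (real CARD('m) * real CARD('n)))"
  have "norm (grad (X (Suc k) \<omega>)) \<le> norm (grad X\<^sub>1) + L * ?r" if "\<omega> \<in> space \<Omega>" for \<omega>
  proof -
    have "norm (grad (X (Suc k) \<omega>)) \<le> norm (grad X\<^sub>1) + norm (grad (X (Suc k) \<omega>) - grad X\<^sub>1)"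
      by (metis add.commute diff_add_cancel norm_triangle_ineq)
    also have "norm (grad (X (Suc k) \<omega>) - grad X\<^sub>1) \<le> L * norm (X (Suc k) \<omega> - X\<^sub>1)"
      by (rule smooth)
    also have "\<dots> \<le> L * ?r"
      using norm_X_le[OF that assms] L_pos by (intro mult_left_mono) auto
    finally show ?thesis by simp
  qed
  then show thesis by (rule that)
qed

lemma square_integrable_grad:
  assumes "k \<le> K" "X (Suc k) \<in> borel_measurable \<Omega>"
  shows "square_integrable \<Omega> (\<lambda>\<omega>. grad (X (Suc k) \<omega>))"
proof -
  obtain c where "\<And>\<omega>. \<omega> \<in> space \<Omega> \<Longrightarrow> norm (grad (X (Suc k) \<omega>)) \<le> c"
    by (rule norm_grad_X_bounded[OF assms(1)]) (rule that)
  then show ?thesis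
    by (rule square_integrable_bounded[OF measurable_compose[OF assms(2) borel_measurable_grad]])
qed

lemma square_integrable_grad_X: "k \<in> {1..K} \<Longrightarrow> square_integrable \<Omega> (\<lambda>\<omega>. grad (X k \<omega>))"
  using square_integrable_grad[of "k - 1"] measurable_X[of k] by fastforce

lemma
  assumes "k \<in> {1..K}"
  shows square_integrable_noise: "square_integrable \<Omega> (\<lambda>\<omega>. G k \<omega> - grad (X k \<omega>))"
    and integral_noise_le: "(\<integral>\<omega>. (norm (G k \<omega> - grad (X k \<omega>)))\<^sup>2 \<partial>\<Omega>) \<le> \<sigma>\<^sup>2"
proof -
  interpret F: finite_measure_subalgebra \<Omega> "\<F> (k - 1)"
    by (rule finite_measure_subalgebra_prev[OF assms])
  have [measurable]: "G k \<in> borel_measurable \<Omega>" "X k \<in> borel_measurable \<Omega>"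
    using measurable_G measurable_X assms by auto
  note * = F.integral_le_of_nn_cond_exp_le[OF _ _ emeasure_space_1 _ bounded_variance[OF assms]]
  show "square_integrable \<Omega> (\<lambda>\<omega>. G k \<omega> - grad (X k \<omega>))"
    unfolding square_integrable_def by (intro conjI *(1)) auto
  show "(\<integral>\<omega>. (norm (G k \<omega> - grad (X k \<omega>)))\<^sup>2 \<partial>\<Omega>) \<le> \<sigma>\<^sup>2"
    by (intro *(2)) auto
qed

lemma square_integrable_G: "k \<in> {1..K} \<Longrightarrow> square_integrable \<Omega> (G k)"
  using square_integrable_add[OF square_integrable_noise square_integrable_grad_X, of k k] by simp

lemma square_integrable_M: "k \<le> K \<Longrightarrow> square_integrable \<Omega> (M k)"
proof (induction k)
  case 0
  have "square_integrable \<Omega> (M 0) \<longleftrightarrow> square_integrable \<Omega> (\<lambda>_. 0 :: real ^ 'n ^ 'm)"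
    by (intro square_integrable_cong M_0)
  then show ?case by (simp add: square_integrable_def)
next
  case (Suc k)
  have "square_integrable \<Omega> (M (Suc k))
      \<longleftrightarrow> square_integrable \<Omega> (\<lambda>\<omega>. (1 - s) *\<^sub>R M k \<omega> + s *\<^sub>R G (Suc k) \<omega>)"
    using M_step[of _ "Suc k"] Suc.prems by (intro square_integrable_cong) simp
  then show ?case
    using Suc by (simp add: square_integrable_add square_integrable_scaleR square_integrable_G)
qed

lemma square_integrable_dir: "k \<in> {1..K} \<Longrightarrow> square_integrable \<Omega> (dir k)"
  by (rule square_integrable_bounded[OF measurable_dir norm_dir_le])

section \<open>Recursions for the expected squared error and the expected gain\<close>

definition "err k = (\<integral>\<omega>. (norm (M k \<omega> - grad (X k \<omega>)))\<^sup>2 \<partial>\<Omega>)"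

text \<open>If the momentum were the exact gradient, this would be the expected first-order decrease
  of \<open>f\<close> per unit of \<open>\<eta>\<close>. It also dominates \<open>\<delta>\<close>
  times the expected squared norm of the direction.\<close>

definition "gain k = (\<integral>\<omega>. M k \<omega> \<bullet> dir k \<omega> \<partial>\<Omega>)"

lemma err_nonneg: "0 \<le> err k"
  unfolding err_def by simp

lemma gain_nonneg: "k \<in> {1..K} \<Longrightarrow> 0 \<le> gain k"
  unfolding gain_def by (intro integral_nonneg_AE AE_I2 inner_dir_nonneg)

lemma integrable_err: "k \<in> {1..K} \<Longrightarrow> integrable \<Omega> (\<lambda>\<omega>. (norm (M k \<omega> - grad (X k \<omega>)))\<^sup>2)"
  using square_integrable_diff[OF square_integrable_M square_integrable_grad_X, of k k]
  by (simp add: square_integrable_def)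

lemma integrable_gain: "k \<in> {1..K} \<Longrightarrow> integrable \<Omega> (\<lambda>\<omega>. M k \<omega> \<bullet> dir k \<omega>)"
  by (intro integrable_inner square_integrable_M square_integrable_dir) auto

text \<open>The new error is \<open>1 - s\<close> times \<open>U\<close>, the old momentum minus the
  current gradient, plus \<open>s\<close> times the noise. \<open>U\<close> is known at time
  \<open>k - 1\<close>, so the cross term vanishes in expectation.\<close>

lemma err_step:
  assumes k: "k \<in> {1..K}"
  shows "err k \<le> (1 - s)\<^sup>2 * (\<integral>\<omega>. (norm (M (k - 1) \<omega> - grad (X k \<omega>)))\<^sup>2 \<partial>\<Omega>) + s\<^sup>2 * \<sigma>\<^sup>2"
proof -
  interpret F: finite_measure_subalgebra \<Omega> "\<F> (k - 1)"
    by (rule finite_measure_subalgebra_prev[OF k])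
  define U where "U \<omega> = M (k - 1) \<omega> - grad (X k \<omega>)" for \<omega>
  define N where "N \<omega> = G k \<omega> - grad (X k \<omega>)" for \<omega>
  have [measurable]: "M (k - 1) \<in> borel_measurable (\<F> (k - 1))" "X k \<in> borel_measurable (\<F> (k - 1))"
    using measurable_prev[OF k] by auto
  have U_meas: "U \<in> borel_measurable (\<F> (k - 1))"
    unfolding U_def[abs_def] by measurable
  have U: "square_integrable \<Omega> U"
    unfolding U_def[abs_def] using k
    by (intro square_integrable_diff square_integrable_M square_integrable_grad_X) auto
  have N: "square_integrable \<Omega> N"
    unfolding N_def[abs_def] by (rule square_integrable_noise[OF k])
  have UN: "(\<integral>\<omega>. U \<omega> \<bullet> N \<omega> \<partial>\<Omega>) = 0"
    unfolding N_def using U_meas U square_integrable_G[OF k] square_integrable_grad_X[OF k] unbiased[OF k]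
    by (rule F.integral_inner_cond_exp_error)
  have eq: "(norm (M k \<omega> - grad (X k \<omega>)))\<^sup>2
      = (1 - s)\<^sup>2 * (norm (U \<omega>))\<^sup>2 + 2 * (1 - s) * s * (U \<omega> \<bullet> N \<omega>) + s\<^sup>2 * (norm (N \<omega>))\<^sup>2"
    if "\<omega> \<in> space \<Omega>" for \<omega>
  proof -
    have "M k \<omega> - grad (X k \<omega>) = (1 - s) *\<^sub>R U \<omega> + s *\<^sub>R N \<omega>"
      by (simp add: M_step[OF that k] U_def N_def algebra_simps)
    then show ?thesis by (simp only: norm_square_combination)
  qed
  have "err k = (\<integral>\<omega>. (1 - s)\<^sup>2 * (norm (U \<omega>))\<^sup>2 + 2 * (1 - s) * s * (U \<omega> \<bullet> N \<omega>)
      + s\<^sup>2 * (norm (N \<omega>))\<^sup>2 \<partial>\<Omega>)"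
    unfolding err_def by (intro Bochner_Integration.integral_cong refl eq)
  also have "\<dots> = (1 - s)\<^sup>2 * (\<integral>\<omega>. (norm (U \<omega>))\<^sup>2 \<partial>\<Omega>) + s\<^sup>2 * (\<integral>\<omega>. (norm (N \<omega>))\<^sup>2 \<partial>\<Omega>)"
    using U N integrable_inner[OF U N] by (simp add: square_integrable_def UN)
  also have "\<dots> \<le> (1 - s)\<^sup>2 * (\<integral>\<omega>. (norm (U \<omega>))\<^sup>2 \<partial>\<Omega>) + s\<^sup>2 * \<sigma>\<^sup>2"
    using integral_noise_le[OF k] unfolding N_def by (intro add_left_mono mult_left_mono) auto
  finally show ?thesis by (simp add: U_def)
qed

text \<open>The integrated form of \<open>momentum_error_drift\<close>, with
  \<open>L * \<eta> = \<delta> * s / 2\<close> as the drift rate. It returns the comparison gradient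
  from \<open>X (Suc k)\<close> to \<open>X k\<close> and so closes the recursion opened by
  \<open>err_step\<close>.\<close>

lemma err_drift:
  assumes k: "k \<in> {1..K}" and "Suc k \<le> K"
  shows "(1 - s)\<^sup>2 * (\<integral>\<omega>. (norm (M k \<omega> - grad (X (Suc k) \<omega>)))\<^sup>2 \<partial>\<Omega>)
    \<le> (1 - s) * err k + (1 - s)\<^sup>2 * s * \<delta> / 4 * gain k"
proof -
  have "integrable \<Omega> (\<lambda>\<omega>. (norm (M k \<omega> - grad (X (Suc k) \<omega>)))\<^sup>2)"
    using square_integrable_diff[OF square_integrable_M square_integrable_grad_X, of k "Suc k"] assms
    by (simp add: square_integrable_def)
  moreover have "(1 - s)\<^sup>2 * (norm (M k \<omega> - grad (X (Suc k) \<omega>)))\<^sup>2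
      \<le> (1 - s) * (norm (M k \<omega> - grad (X k \<omega>)))\<^sup>2 + (1 - s)\<^sup>2 * s * \<delta> / 4 * (M k \<omega> \<bullet> dir k \<omega>)"
    if "\<omega> \<in> space \<Omega>" for \<omega>
  proof (rule momentum_error_drift[OF s \<delta>_pos norm_dir_square_le[OF that k]])
    have "norm (grad (X (Suc k) \<omega>) - grad (X k \<omega>)) \<le> L * norm (X (Suc k) \<omega> - X k \<omega>)"
      by (rule smooth)
    also have "\<dots> = \<delta> * s / 2 * norm (dir k \<omega>)"
    proof -
      have "norm (X (Suc k) \<omega> - X k \<omega>) = \<eta> * norm (dir k \<omega>)"
        using X_step[OF that k] \<eta>_pos by simp
      moreover have "L * \<eta> = \<delta> * s / 2" using L_pos by (simp add: \<eta>)
      ultimately show ?thesis by (metis mult.assoc)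
    qed
    finally show "norm (grad (X (Suc k) \<omega>) - grad (X k \<omega>)) \<le> \<delta> * s / 2 * norm (dir k \<omega>)" .
  qed
  ultimately have "(\<integral>\<omega>. (1 - s)\<^sup>2 * (norm (M k \<omega> - grad (X (Suc k) \<omega>)))\<^sup>2 \<partial>\<Omega>)
      \<le> (\<integral>\<omega>. (1 - s) * (norm (M k \<omega> - grad (X k \<omega>)))\<^sup>2
          + (1 - s)\<^sup>2 * s * \<delta> / 4 * (M k \<omega> \<bullet> dir k \<omega>) \<partial>\<Omega>)"
    using integrable_err[OF k] integrable_gain[OF k]
    by (intro integral_mono) auto
  then show ?thesis
    using integrable_err[OF k] integrable_gain[OF k] by (simp add: err_def gain_def)
qed

text \<open>Adds up the one-step recursion without unrolling it: the right side keeps the sum of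
  earlier errors with factor \<open>1 - s\<close>, which is absorbed in the next lemma.\<close>

lemma sum_err_le_aux:
  "Suc n \<le> K \<Longrightarrow> (\<Sum>k=1..Suc n. err k)
    \<le> (1 - s)\<^sup>2 * (norm (grad X\<^sub>1))\<^sup>2 + real (Suc n) * (s\<^sup>2 * \<sigma>\<^sup>2)
      + (1 - s) * (\<Sum>k=1..n. err k) + (1 - s)\<^sup>2 * s * \<delta> / 4 * (\<Sum>k=1..n. gain k)"
proof (induction n)
  case 0
  \<comment> \<open>Since \<open>M 0 = 0\<close> and \<open>X 1\<close> is deterministic, the error
    before the first sample is the fixed gradient at \<open>X\<^sub>1\<close>.\<close>
  have "(\<integral>\<omega>. (norm (M 0 \<omega> - grad (X 1 \<omega>)))\<^sup>2 \<partial>\<Omega>) = (\<integral>\<omega>. (norm (grad X\<^sub>1))\<^sup>2 \<partial>\<Omega>)"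
    using X_1 by (intro Bochner_Integration.integral_cong) (auto simp: M_0)
  then show ?case using err_step[of 1] 0 by (simp add: prob_space)
next
  case (Suc n)
  then show ?case
    using err_step[of "Suc (Suc n)"] err_drift[of "Suc n"] by (simp add: algebra_simps)
qed

text \<open>Errors and gains are nonnegative, so the sums on the right may run up to
  \<open>K\<close>. Subtracting \<open>1 - s\<close> times the error sum from both sides leaves the
  factor \<open>s\<close>.\<close>

lemma sum_err_le:
  assumes "1 \<le> K"
  shows "s * (\<Sum>k=1..K. err k) \<le> (1 - s)\<^sup>2 * (norm (grad X\<^sub>1))\<^sup>2 + real K * (s\<^sup>2 * \<sigma>\<^sup>2)
      + (1 - s)\<^sup>2 * s * \<delta> / 4 * (\<Sum>k=1..K. gain k)"
proof -
  obtain n where n: "K = Suc n" using assms by (cases K) auto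
  have "(\<Sum>k=1..n. err k) \<le> (\<Sum>k=1..K. err k)" "(\<Sum>k=1..n. gain k) \<le> (\<Sum>k=1..K. gain k)"
    using err_nonneg gain_nonneg[of K] n by auto
  then have "(1 - s) * (\<Sum>k=1..n. err k) \<le> (1 - s) * (\<Sum>k=1..K. err k)"
    "(1 - s)\<^sup>2 * s * \<delta> / 4 * (\<Sum>k=1..n. gain k) \<le> (1 - s)\<^sup>2 * s * \<delta> / 4 * (\<Sum>k=1..K. gain k)"
    using s \<delta>_pos by (auto intro!: mult_left_mono)
  then show ?thesis using sum_err_le_aux[of n] n by (simp add: algebra_simps)
qed

text \<open>The function values telescope on each sample path before expectations are taken, and the
  last one is at least \<open>b\<close>. In this way integrability of \<open>f\<close> along the
  iterates never has to be discussed.\<close>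

lemma sum_gain_le:
  "(5 / 8 - s / 4) * (\<Sum>k=1..K. gain k) \<le> (f X\<^sub>1 - b) / \<eta> + 2 / (3 * \<delta>) * (\<Sum>k=1..K. err k)"
proof -
  have "(\<Sum>k=1..K. (5 / 8 - s / 4) * (M k \<omega> \<bullet> dir k \<omega>))
      \<le> (f X\<^sub>1 - b) / \<eta> + (\<Sum>k=1..K. 2 / (3 * \<delta>) * (norm (M k \<omega> - grad (X k \<omega>)))\<^sup>2)"
    if "\<omega> \<in> space \<Omega>" for \<omega>
  proof -
    have "(\<Sum>k=1..K. (5 / 8 - s / 4) * (M k \<omega> \<bullet> dir k \<omega>))
      \<le> (\<Sum>k=1..K. (f (X k \<omega>) - f (X (k + 1) \<omega>)) / \<eta>
          + 2 / (3 * \<delta>) * (norm (M k \<omega> - grad (X k \<omega>)))\<^sup>2)"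
      using momentum_step_descent[OF gderiv smooth L_pos \<delta>_pos s(1) \<eta> norm_dir_square_le[OF that]]
        X_step[OF that] by (intro sum_mono) simp
    also have "\<dots> = (\<Sum>k=1..K. f (X k \<omega>) - f (X (Suc k) \<omega>)) / \<eta>
        + (\<Sum>k=1..K. 2 / (3 * \<delta>) * (norm (M k \<omega> - grad (X k \<omega>)))\<^sup>2)"
      by (simp add: sum.distrib sum_divide_distrib)
    also have "(\<Sum>k=1..K. f (X k \<omega>) - f (X (Suc k) \<omega>)) = f X\<^sub>1 - f (X (Suc K) \<omega>)"
      using X_1[OF that] by (induction K) auto
    also have "(f X\<^sub>1 - f (X (Suc K) \<omega>)) / \<eta> \<le> (f X\<^sub>1 - b) / \<eta>"
      using lower \<eta>_pos by (intro divide_right_mono) auto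
    finally show ?thesis by simp
  qed
  moreover have e: "integrable \<Omega> (\<lambda>\<omega>. \<Sum>k=1..K. 2 / (3 * \<delta>) * (norm (M k \<omega> - grad (X k \<omega>)))\<^sup>2)"
    and a: "integrable \<Omega> (\<lambda>\<omega>. \<Sum>k=1..K. (5 / 8 - s / 4) * (M k \<omega> \<bullet> dir k \<omega>))"
    by (intro Bochner_Integration.integrable_sum integrable_mult_right integrable_err integrable_gain; assumption)+
  ultimately have "(\<integral>\<omega>. (\<Sum>k=1..K. (5 / 8 - s / 4) * (M k \<omega> \<bullet> dir k \<omega>)) \<partial>\<Omega>)
      \<le> (\<integral>\<omega>. (f X\<^sub>1 - b) / \<eta> + (\<Sum>k=1..K. 2 / (3 * \<delta>) * (norm (M k \<omega> - grad (X k \<omega>)))\<^sup>2) \<partial>\<Omega>)"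
    by (intro integral_mono Bochner_Integration.integrable_add integrable_const)
  also have "\<dots> = (f X\<^sub>1 - b) / \<eta>
      + (\<integral>\<omega>. (\<Sum>k=1..K. 2 / (3 * \<delta>) * (norm (M k \<omega> - grad (X k \<omega>)))\<^sup>2) \<partial>\<Omega>)"
    by (subst Bochner_Integration.integral_add[OF integrable_const e]) (simp add: prob_space)
  also have "(\<integral>\<omega>. (\<Sum>k=1..K. 2 / (3 * \<delta>) * (norm (M k \<omega> - grad (X k \<omega>)))\<^sup>2) \<partial>\<Omega>)
      = 2 / (3 * \<delta>) * (\<Sum>k=1..K. err k)"
    unfolding err_def sum_distrib_left using integrable_err
    by (subst Bochner_Integration.integral_sum) (auto intro: integrable_mult_right)
  also have "(\<integral>\<omega>. (\<Sum>k=1..K. (5 / 8 - s / 4) * (M k \<omega> \<bullet> dir k \<omega>)) \<partial>\<Omega>)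
      = (5 / 8 - s / 4) * (\<Sum>k=1..K. gain k)"
    unfolding gain_def sum_distrib_left using integrable_gain
    by (subst Bochner_Integration.integral_sum) (auto intro: integrable_mult_right)
  finally show ?thesis .
qed

text \<open>With \<open>u = K * s * \<rho>\<^sup>2\<close>, the two preceding lemmas become linear
  inequalities between the error sum \<open>e\<close> and the scaled gain sum \<open>a\<close>.
  Inserting the bound on \<open>e\<close> into the one on \<open>a\<close> gives the first claim,
  and going back gives the second. The number \<open>\<rho>\<close> stands for
  \<open>\<sigma>h\<close>.\<close>

lemma
  assumes K: "1 \<le> K" and \<rho>: "\<sigma>\<^sup>2 \<le> \<rho>\<^sup>2" "L * (f X\<^sub>1 - b) = real K * s\<^sup>2 * \<rho>\<^sup>2"
  shows sum_gain_bound: "\<delta> * (\<Sum>k=1..K. gain k) \<le> 9 * (real K * s * \<rho>\<^sup>2)"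
    and sum_err_bound: "(\<Sum>k=1..K. err k) \<le> 21 / 4 * (real K * s * \<rho>\<^sup>2)"
proof -
  define u e a where "u = real K * s * \<rho>\<^sup>2" and "e = (\<Sum>k=1..K. err k)"
    and "a = \<delta> * (\<Sum>k=1..K. gain k)"
  have u: "0 \<le> u" and a: "0 \<le> a"
    using s \<delta>_pos gain_nonneg by (auto simp: u_def a_def intro!: mult_nonneg_nonneg sum_nonneg)
  have sq: "(1 - s)\<^sup>2 \<le> 1 - s"
    using s by (simp add: power2_eq_square mult_left_le)
  have "(norm (grad X\<^sub>1))\<^sup>2 \<le> 2 * L * (f X\<^sub>1 - b)"
    using gderiv smooth L_pos lower by (rule norm_gradient_square_le)
  also have "\<dots> = s * (2 * u)"
    using \<rho>(2) by (simp add: u_def power2_eq_square)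
  finally have n: "(norm (grad X\<^sub>1))\<^sup>2 \<le> s * (2 * u)" .
  have "s * e \<le> (1 - s)\<^sup>2 * (s * (2 * u)) + s * u + (1 - s)\<^sup>2 * (s * a / 4)"
  proof -
    have "(1 - s)\<^sup>2 * (norm (grad X\<^sub>1))\<^sup>2 \<le> (1 - s)\<^sup>2 * (s * (2 * u))"
      using n by (intro mult_left_mono) auto
    moreover have "real K * (s\<^sup>2 * \<sigma>\<^sup>2) \<le> s * u"
    proof -
      have "real K * (s\<^sup>2 * \<sigma>\<^sup>2) \<le> real K * (s\<^sup>2 * \<rho>\<^sup>2)"
        using \<rho>(1) by (intro mult_left_mono) auto
      then show ?thesis by (simp add: u_def power2_eq_square algebra_simps)
    qed
    moreover have "(1 - s)\<^sup>2 * s * \<delta> / 4 * (\<Sum>k=1..K. gain k) = (1 - s)\<^sup>2 * (s * a / 4)"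
      by (simp add: a_def)
    ultimately show ?thesis using sum_err_le[OF K] unfolding e_def by linarith
  qed
  also have "\<dots> = s * ((1 - s)\<^sup>2 * (2 * u + a / 4) + u)" by (simp add: algebra_simps)
  finally have "e \<le> (1 - s)\<^sup>2 * (2 * u + a / 4) + u" using s by simp
  also have "\<dots> \<le> (1 - s) * (2 * u + a / 4) + u"
    using sq u a by (intro add_right_mono mult_right_mono) auto
  finally have e: "e \<le> (1 - s) * (2 * u + a / 4) + u" .
  have "(5 / 8 - s / 4) * a = \<delta> * ((5 / 8 - s / 4) * (\<Sum>k=1..K. gain k))" by (simp add: a_def)
  also have "\<dots> \<le> \<delta> * ((f X\<^sub>1 - b) / \<eta> + 2 / (3 * \<delta>) * e)"
    unfolding e_def using sum_gain_le \<delta>_pos by (intro mult_left_mono) auto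
  also have "\<dots> = 2 * (L * (f X\<^sub>1 - b)) / s + 2 / 3 * e"
    using \<delta>_pos s L_pos by (simp add: \<eta> field_simps)
  also have "2 * (L * (f X\<^sub>1 - b)) / s = 2 * u"
    using s by (simp add: \<rho>(2) u_def power2_eq_square)
  also have "2 * u + 2 / 3 * e \<le> 2 * u + 2 / 3 * ((1 - s) * (2 * u + a / 4) + u)"
    using e by simp
  finally have "(5 / 8 - s / 4) * a \<le> 2 * u + 2 / 3 * ((1 - s) * (2 * u + a / 4) + u)" .
  \<comment> \<open>Multiplication by 24 after the terms in \<open>a\<close> are collected:
    \<open>5 / 8 - s / 4 - (1 - s) / 6 = (11 - 2 * s) / 24\<close>.\<close>
  then have "(11 - 2 * s) * a \<le> (96 - 32 * s) * u" by (simp add: field_simps)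
  \<comment> \<open>The ratio \<open>(96 - 32 * s) / (11 - 2 * s)\<close> is largest at
    \<open>s = 0\<close>, where it is \<open>96 / 11\<close>; the constant 9 rounds it up.\<close>
  also have "\<dots> \<le> (99 - 18 * s) * u"
    using s u by (intro mult_right_mono) auto
  also have "\<dots> = (11 - 2 * s) * (9 * u)" by (simp add: algebra_simps)
  finally have a9: "a \<le> 9 * u" using s by simp
  then show "\<delta> * (\<Sum>k=1..K. gain k) \<le> 9 * (real K * s * \<rho>\<^sup>2)" by (simp add: a_def u_def)
  \<comment> \<open>Dropping the factor \<open>1 - s\<close> gives
    \<open>2 + 9 / 4 + 1 = 21 / 4\<close>.\<close>
  have "(1 - s) * (2 * u + a / 4) \<le> 1 * (2 * u + a / 4)"
    using s u a by (intro mult_right_mono) auto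
  then have "e \<le> 1 * (2 * u + a / 4) + u"
    using e by (meson add_right_mono order_trans)
  then have "e \<le> 21 / 4 * u" using a9 by simp
  then show "(\<Sum>k=1..K. err k) \<le> 21 / 4 * (real K * s * \<rho>\<^sup>2)" by (simp add: e_def u_def)
qed

section \<open>The nuclear norm of the gradient in expectation\<close>

lemma integrable_nuclear_norm_grad:
  assumes k: "k \<in> {1..K}"
  shows "integrable \<Omega> (\<lambda>\<omega>. nuclear_norm (grad (X k \<omega>)))"
proof -
  have [measurable]: "X k \<in> borel_measurable \<Omega>" using measurable_X[OF k] .
  have [measurable]: "(nuclear_norm :: real ^ 'n ^ 'm \<Rightarrow> real) \<in> borel_measurable borel"
    by (intro borel_measurable_continuous_onI continuous_on_nuclear_norm)
  obtain c where c: "\<And>\<omega>. \<omega> \<in> space \<Omega> \<Longrightarrow> norm (grad (X k \<omega>)) \<le> c"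
  proof -
    have "k - 1 \<le> K" "Suc (k - 1) = k" using k by auto
    then show thesis using norm_grad_X_bounded[of "k - 1"] that by metis
  qed
  have "norm (nuclear_norm (grad (X k \<omega>))) \<le> sqrt (real CARD('n)) * c" if "\<omega> \<in> space \<Omega>" for \<omega>
  proof -
    have "nuclear_norm (grad (X k \<omega>)) \<le> sqrt (real CARD('n)) * norm (grad (X k \<omega>))"
      by (rule nuclear_norm_le_norm)
    also have "\<dots> \<le> sqrt (real CARD('n)) * c"
      by (intro mult_left_mono c that) simp
    finally show ?thesis by (simp add: nuclear_norm_nonneg)
  qed
  then show ?thesis by (intro integrable_const_bound AE_I2) auto
qed

text \<open>Young's inequality with weight \<kappa> replaces the two square roots by squares on each
  path, so that only \<open>err\<close> and \<open>gain\<close> remain after integration. A single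
  \<kappa> for all \<open>k\<close> also does the work of Jensen's inequality over the
  steps.\<close>

lemma integral_nuclear_norm_grad_le:
  assumes k: "k \<in> {1..K}" and \<kappa>: "0 < \<kappa>" and N: "sqrt (real CARD('n)) \<le> N"
  shows "(\<integral>\<omega>. nuclear_norm (grad (X k \<omega>)) \<partial>\<Omega>)
    \<le> gain k + N * ((err k + \<delta> * gain k) / (2 * \<kappa>) + \<kappa>)"
proof -
  have young: "x \<le> x\<^sup>2 / (2 * \<kappa>) + \<kappa> / 2" for x
  proof -
    have "0 \<le> (x - \<kappa>)\<^sup>2 / (2 * \<kappa>)" using \<kappa> by simp
    also have "\<dots> = x\<^sup>2 / (2 * \<kappa>) + \<kappa> / 2 - x"
      using \<kappa> by (simp add: power2_eq_square field_simps)
    finally show ?thesis by simp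
  qed
  let ?a = "\<lambda>\<omega>. M k \<omega> \<bullet> dir k \<omega>" and ?e = "\<lambda>\<omega>. (norm (M k \<omega> - grad (X k \<omega>)))\<^sup>2"
  have N0: "0 \<le> N" using N order_trans[OF real_sqrt_ge_zero N] by simp
  have "nuclear_norm (grad (X k \<omega>)) \<le> ?a \<omega> + N * ((?e \<omega> + \<delta> * ?a \<omega>) / (2 * \<kappa>) + \<kappa>)"
    if \<omega>: "\<omega> \<in> space \<Omega>" for \<omega>
  proof -
    have "0 \<le> \<delta> * ?a \<omega>" using inner_dir_nonneg[OF \<omega> k] \<delta>_pos by simp
    have "nuclear_norm (grad (X k \<omega>))
        \<le> ?a \<omega> + sqrt (real CARD('n)) * (norm (M k \<omega> - grad (X k \<omega>)) + sqrt (\<delta> * ?a \<omega>))"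
      unfolding dir_def by (intro nuclear_norm_le_splus_direction \<delta>_pos orthogonal_P[OF \<omega> k] orthogonal_Q[OF \<omega> k])
    also have "sqrt (real CARD('n)) * (norm (M k \<omega> - grad (X k \<omega>)) + sqrt (\<delta> * ?a \<omega>))
        \<le> N * (norm (M k \<omega> - grad (X k \<omega>)) + sqrt (\<delta> * ?a \<omega>))"
      using N \<open>0 \<le> \<delta> * ?a \<omega>\<close> by (intro mult_right_mono add_nonneg_nonneg) auto
    also have "norm (M k \<omega> - grad (X k \<omega>)) + sqrt (\<delta> * ?a \<omega>) \<le> (?e \<omega> + \<delta> * ?a \<omega>) / (2 * \<kappa>) + \<kappa>"
      using young[of "norm (M k \<omega> - grad (X k \<omega>))"] young[of "sqrt (\<delta> * ?a \<omega>)"] \<open>0 \<le> \<delta> * ?a \<omega>\<close>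
      by (simp add: add_divide_distrib)
    finally show ?thesis using N0 by (simp add: mult_left_mono)
  qed
  then have "(\<integral>\<omega>. nuclear_norm (grad (X k \<omega>)) \<partial>\<Omega>)
      \<le> (\<integral>\<omega>. ?a \<omega> + N * ((?e \<omega> + \<delta> * ?a \<omega>) / (2 * \<kappa>) + \<kappa>) \<partial>\<Omega>)"
    using integrable_err[OF k] integrable_gain[OF k] integrable_nuclear_norm_grad[OF k]
    by (intro integral_mono) auto
  also have "\<dots> = gain k + N * ((err k + \<delta> * gain k) / (2 * \<kappa>) + \<kappa>)"
    using integrable_err[OF k] integrable_gain[OF k] by (simp add: err_def gain_def prob_space)
  finally show ?thesis .
qed

lemma sum_nuclear_norm_grad_le:
  assumes K: "1 \<le> K" and \<rho>: "\<sigma>\<^sup>2 \<le> \<rho>\<^sup>2" "L * (f X\<^sub>1 - b) = real K * s\<^sup>2 * \<rho>\<^sup>2" "0 < \<rho>"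
    and N: "sqrt (real CARD('n)) \<le> N"
  shows "(\<Sum>k=1..K. \<integral>\<omega>. nuclear_norm (grad (X k \<omega>)) \<partial>\<Omega>)
    \<le> 9 * (real K * s * \<rho>\<^sup>2) / \<delta> + 43 / 8 * (N * (real K * \<rho> * sqrt s))"
proof -
  \<comment> \<open>The squares average to at most \<open>57 / 4 * s * \<rho>\<^sup>2\<close>, where
    \<open>57 / 4 = 21 / 4 + 9\<close>. The best factor in front of \<open>\<rho> * sqrt s\<close>
    would be \<open>sqrt (57 / 8)\<close>, about 2.67; 3 keeps the arithmetic rational.\<close>
  let ?\<kappa> = "3 * \<rho> * sqrt s"
  let ?e = "\<Sum>k=1..K. err k" and ?a = "\<Sum>k=1..K. gain k"
  have \<kappa>: "0 < ?\<kappa>" using s \<rho>(3) by simp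
  have N0: "0 \<le> N" using N order_trans[OF real_sqrt_ge_zero N] by simp
  have "(\<Sum>k=1..K. \<integral>\<omega>. nuclear_norm (grad (X k \<omega>)) \<partial>\<Omega>)
      \<le> (\<Sum>k=1..K. gain k + N * ((err k + \<delta> * gain k) / (2 * ?\<kappa>) + ?\<kappa>))"
    using \<kappa> N by (intro sum_mono integral_nuclear_norm_grad_le) auto
  also have "\<dots> = ?a + N * ((?e + \<delta> * ?a) / (2 * ?\<kappa>) + real K * ?\<kappa>)"
    by (simp add: sum.distrib sum_distrib_left[symmetric] sum_divide_distrib[symmetric])
  also have "\<dots> \<le> 9 * (real K * s * \<rho>\<^sup>2) / \<delta>
      + N * (57 / 4 * (real K * s * \<rho>\<^sup>2) / (2 * ?\<kappa>) + real K * ?\<kappa>)"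
  proof (intro add_mono mult_left_mono divide_right_mono)
    show "?a \<le> 9 * (real K * s * \<rho>\<^sup>2) / \<delta>"
      using sum_gain_bound[OF K \<rho>(1,2)] \<delta>_pos by (simp add: pos_le_divide_eq mult.commute)
    show "?e + \<delta> * ?a \<le> 57 / 4 * (real K * s * \<rho>\<^sup>2)"
      using sum_gain_bound[OF K \<rho>(1,2)] sum_err_bound[OF K \<rho>(1,2)] by simp
  qed (use \<kappa> N0 \<rho>(3) s in auto)
  \<comment> \<open>The constant is \<open>57 / 24 + 3 = 43 / 8\<close>.\<close>
  also have "57 / 4 * (real K * s * \<rho>\<^sup>2) / (2 * ?\<kappa>) + real K * ?\<kappa> = 43 / 8 * (real K * \<rho> * sqrt s)"
  proof -
    have "s * \<rho>\<^sup>2 = (\<rho> * sqrt s) * (\<rho> * sqrt s)" using s by (simp add: power2_eq_square)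
    then show ?thesis using s \<rho>(3) by (simp add: field_simps)
  qed
  finally show ?thesis by (simp add: algebra_simps)
qed

end

section \<open>Insertion of the prescribed parameters\<close>

lemma root_4_square_square:
  assumes "0 \<le> a" "0 \<le> s"
  shows "root 4 (a\<^sup>2 * (s\<^sup>2 * a\<^sup>2)) = a * sqrt s"
proof (rule real_root_pos_unique)
  have "(a * sqrt s) ^ 4 = a ^ 4 * ((sqrt s)\<^sup>2)\<^sup>2"
    by (simp add: power_mult_distrib flip: power_mult)
  then show "(a * sqrt s) ^ 4 = a\<^sup>2 * (s\<^sup>2 * a\<^sup>2)"
    using assms(2) by (simp add: power4_eq_xxxx power2_eq_square)
qed (use assms in auto)

theorem theorem2:
  fixes f :: "real ^ 'n ^ 'm \<Rightarrow> real"
    and grad :: "real ^ 'n ^ 'm \<Rightarrow> real ^ 'n ^ 'm"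
    and D :: "'z measure" and fs :: "real ^ 'n ^ 'm \<Rightarrow> 'z \<Rightarrow> real"
    and \<Omega> :: "'a measure" and \<zeta> :: "nat \<Rightarrow> 'a \<Rightarrow> 'z"
    and \<F> :: "nat \<Rightarrow> 'a measure"
    and g :: "nat \<Rightarrow> real ^ 'n ^ 'm \<Rightarrow> 'z \<Rightarrow> real ^ 'n ^ 'm"
    and G :: "nat \<Rightarrow> 'a \<Rightarrow> real ^ 'n ^ 'm"
    and P :: "nat \<Rightarrow> 'a \<Rightarrow> real ^ 'm ^ 'm" and Q :: "nat \<Rightarrow> 'a \<Rightarrow> real ^ 'n ^ 'n"
    and M X :: "nat \<Rightarrow> 'a \<Rightarrow> real ^ 'n ^ 'm"
    and X\<^sub>1 :: "real ^ 'n ^ 'm"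
    and K :: nat and L \<sigma> \<sigma>h \<gamma> \<tau> \<theta> \<eta> \<delta> fstar :: real
  assumes "prob_space D"
    and "\<forall>Y. integrable D (fs Y) \<and> f Y = (\<integral>z. fs Y z \<partial>D)"
    and "\<forall>Y. GDERIV f Y :> grad Y"
    and "bdd_below (range f)"
    and "fstar = (INF Y. f Y)"
    and "L > 0" and "\<sigma> \<ge> 0" and "K \<ge> 1"
    and "prob_space \<Omega>"
    and "\<forall>k\<in>{1..K}. \<zeta> k \<in> measurable \<Omega> D"
    and "\<forall>k. \<F> k = natural_filtration \<Omega> D \<zeta> k"
    and "\<forall>k\<in>{1..K}. (\<lambda>(Y, z). g k Y z) \<in> borel_measurable (borel \<Otimes>\<^sub>M D)"
    and "\<forall>k\<in>{1..K}. \<forall>\<omega>\<in>space \<Omega>. G k \<omega> = g k (X k \<omega>) (\<zeta> k \<omega>)"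
    and "\<forall>k\<in>{1..K}. P k \<in> borel_measurable (\<F> k) \<and> Q k \<in> borel_measurable (\<F> k)"
    and run: "\<forall>\<omega>\<in>space \<Omega>. truncated_splus_run \<eta> \<theta> \<delta> K X\<^sub>1
          (\<lambda>k. G k \<omega>) (\<lambda>k. P k \<omega>) (\<lambda>k. Q k \<omega>) (\<lambda>k. M k \<omega>) (\<lambda>k. X k \<omega>)"
    and smooth: "\<forall>Y Z. norm (grad Z - grad Y) \<le> L * norm (Z - Y)"
    and unbiased: "\<forall>k\<in>{1..K}. AE \<omega> in \<Omega>. \<forall>i j.
          real_cond_exp \<Omega> (\<F> (k - 1)) (\<lambda>\<omega>. G k \<omega> $ i $ j) \<omega> = grad (X k \<omega>) $ i $ j"
    and bounded_variance: "\<forall>k\<in>{1..K}. AE \<omega> in \<Omega>.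
          nn_cond_exp \<Omega> (\<F> (k - 1)) (\<lambda>\<omega>. ennreal ((norm (G k \<omega> - grad (X k \<omega>)))\<^sup>2)) \<omega>
            \<le> ennreal (\<sigma>\<^sup>2)"
    and "0 < \<gamma>" "\<gamma> \<le> 1" "0 < \<tau>" "\<tau> \<le> 1"
    and "\<sigma>h > 0"
    and "\<sigma>h\<^sup>2 = max (\<sigma>\<^sup>2) (L * (f X\<^sub>1 - fstar) / (real K * \<gamma>\<^sup>2))"
    and "1 - \<theta> = sqrt (L * (f X\<^sub>1 - fstar) / (real K * \<sigma>h\<^sup>2))"
    and "\<eta> = sqrt (\<delta>\<^sup>2 * (f X\<^sub>1 - fstar) / (4 * L * real K * \<sigma>h\<^sup>2))"
    and "\<delta> = \<tau> * \<sigma>h / sqrt (real (CARD('m) + CARD('n)))"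
  shows "(\<forall>k\<in>{1..K}. integrable \<Omega> (\<lambda>\<omega>. nuclear_norm (grad (X k \<omega>)))) \<and>
    (1 / real K) * (\<Sum>k=1..K. \<integral>\<omega>. nuclear_norm (grad (X k \<omega>)) \<partial>\<Omega>)
      \<le> (4 + 11 / \<tau>) * sqrt (real (CARD('m) + CARD('n)))
          * root 4 (\<sigma>h\<^sup>2 * L * (f X\<^sub>1 - fstar) / real K)"
proof -
  define \<Delta> where "\<Delta> = f X\<^sub>1 - fstar"
  define s where "s = 1 - \<theta>"
  define N where "N = sqrt (real (CARD('m) + CARD('n)))"
  have gderiv: "\<And>Y. GDERIV f Y :> grad Y" and smooth': "\<And>Y Z. norm (grad Z - grad Y) \<le> L * norm (Z - Y)"
    using assms by auto
  have lower: "fstar \<le> f Y" for Y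
    using assms by (auto intro: cINF_lower)
  have K: "1 \<le> K" and L: "0 < L" and \<sigma>h: "0 < \<sigma>h" and \<tau>: "0 < \<tau>" "\<tau> \<le> 1" and \<gamma>: "0 < \<gamma>" "\<gamma> \<le> 1"
    using assms by auto
  have N: "0 < N" "sqrt (real CARD('n)) \<le> N" by (simp_all add: N_def add_pos_pos)
  have \<delta>_eq: "\<delta> = \<tau> * \<sigma>h / N" using assms by (simp add: N_def)
  have \<delta>: "0 < \<delta>" using \<tau> \<sigma>h N by (simp add: \<delta>_eq)
  have \<Delta>: "0 \<le> \<Delta>" using lower by (simp add: \<Delta>_def)
  have s_eq: "s = sqrt (L * \<Delta> / (real K * \<sigma>h\<^sup>2))"
    and \<eta>_eq: "\<eta> = sqrt (\<delta>\<^sup>2 * \<Delta> / (4 * L * real K * \<sigma>h\<^sup>2))"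
    using assms by (simp_all add: s_def \<Delta>_def)
  have s0: "0 \<le> s" using K L \<Delta> by (simp add: s_eq)
  have s_sq: "s\<^sup>2 = L * \<Delta> / (real K * \<sigma>h\<^sup>2)" using K L \<Delta> by (simp add: s_eq)
  \<comment> \<open>The formula for \<open>1 - \<theta>\<close> solved for the initial gap; from
    here on the gap is expressed through \<open>s\<close>.\<close>
  have \<Delta>_eq: "L * \<Delta> = real K * s\<^sup>2 * \<sigma>h\<^sup>2" using K \<sigma>h by (simp add: s_sq)
  have \<sigma>h_sq: "\<sigma>h\<^sup>2 = max (\<sigma>\<^sup>2) (L * \<Delta> / (real K * \<gamma>\<^sup>2))" using assms by (simp add: \<Delta>_def)
  \<comment> \<open>The second term of the maximum in \<open>\<sigma>h\<^sup>2\<close> is there for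
    this: it forces \<open>s \<le> \<gamma>\<close>.\<close>
  have s1: "s \<le> 1"
  proof -
    have "s\<^sup>2 * \<sigma>h\<^sup>2 = \<gamma>\<^sup>2 * (L * \<Delta> / (real K * \<gamma>\<^sup>2))"
      using \<Delta>_eq K \<gamma> by simp
    also have "\<dots> \<le> \<gamma>\<^sup>2 * \<sigma>h\<^sup>2"
      unfolding \<sigma>h_sq by (intro mult_left_mono) auto
    finally have "s\<^sup>2 \<le> \<gamma>\<^sup>2" using \<sigma>h by simp
    then have "s \<le> \<gamma>" using \<gamma>(1) by (auto intro: power2_le_imp_le)
    then show ?thesis using \<gamma> by simp
  qed
  have \<eta>: "\<eta> = \<delta> * s / (2 * L)"
  proof -
    have "\<delta>\<^sup>2 * \<Delta> / (4 * L * real K * \<sigma>h\<^sup>2) = (\<delta> / (2 * L))\<^sup>2 * (L * \<Delta> / (real K * \<sigma>h\<^sup>2))"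
      using L by (simp add: power2_eq_square)
    then have "\<eta> = sqrt ((\<delta> / (2 * L))\<^sup>2) * s"
      by (simp only: \<eta>_eq s_eq real_sqrt_mult)
    then show ?thesis using \<delta> L by simp
  qed
  have root: "root 4 (\<sigma>h\<^sup>2 * L * (f X\<^sub>1 - fstar) / real K) = \<sigma>h * sqrt s"
  proof -
    have "\<sigma>h\<^sup>2 * L * (f X\<^sub>1 - fstar) / real K = \<sigma>h\<^sup>2 * (s\<^sup>2 * \<sigma>h\<^sup>2)"
      using \<Delta>_eq K by (simp add: \<Delta>_def[symmetric] mult.assoc)
    then show ?thesis using root_4_square_square[of \<sigma>h s] s0 \<sigma>h by simp
  qed
  show ?thesis
  proof (cases "s = 0")
    \<comment> \<open>With \<open>s = 0\<close> the initial gap is zero, so \<open>X\<^sub>1\<close>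
      is a minimiser with vanishing gradient. Since also \<open>\<eta> = 0\<close>, the iterates
      never move and both sides are zero.\<close>
    case True
    then have "\<eta> = 0" "\<Delta> = 0" using \<eta> \<Delta>_eq L by auto
    then have "grad X\<^sub>1 = 0"
      using lower by (intro gradient_at_minimum[OF gderiv smooth' L]) (simp add: \<Delta>_def)
    have "X (Suc k) \<omega> = X\<^sub>1" if "\<omega> \<in> space \<Omega>" "k \<le> K" for k \<omega>
      using that(2)
    proof (induction k)
      case 0
      show ?case using run that(1) by (auto simp: truncated_splus_run_def)
    next
      case (Suc k)
      have "X (Suc (Suc k)) \<omega> = X (Suc k) \<omega>"
        using run that(1) Suc.prems \<open>\<eta> = 0\<close> by (auto simp: truncated_splus_run_def)
      then show ?case using Suc by simp
    qed
    then have "X k \<omega> = X\<^sub>1" if "\<omega> \<in> space \<Omega>" "k \<in> {1..K}" for k \<omega>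
      using that(2) that(1) by (cases k) auto
    then have zero: "nuclear_norm (grad (X k \<omega>)) = 0" if "\<omega> \<in> space \<Omega>" "k \<in> {1..K}" for k \<omega>
      using that \<open>grad X\<^sub>1 = 0\<close> by (simp add: nuclear_norm_zero)
    have "integrable \<Omega> (\<lambda>\<omega>. nuclear_norm (grad (X k \<omega>))) \<longleftrightarrow> integrable \<Omega> (\<lambda>\<omega>. 0 :: real)"
      and "(\<integral>\<omega>. nuclear_norm (grad (X k \<omega>)) \<partial>\<Omega>) = (\<integral>\<omega>. 0 \<partial>\<Omega>)" if "k \<in> {1..K}" for k
      using zero[OF _ that]
      by (intro Bochner_Integration.integrable_cong Bochner_Integration.integral_cong refl; blast)+
    then show ?thesis unfolding root by (simp add: True)
  next
    case False
    interpret splus_process \<Omega> D \<zeta> g G M X P Q f grad X\<^sub>1 K L \<sigma> \<eta> s \<delta> fstar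
    proof (intro splus_process.intro splus_process_axioms.intro)
      show "prob_space \<Omega>" by fact
      show "0 < s" using False s0 by simp
      show "truncated_splus_run \<eta> (1 - s) \<delta> K X\<^sub>1
          (\<lambda>k. G k \<omega>) (\<lambda>k. P k \<omega>) (\<lambda>k. Q k \<omega>) (\<lambda>k. M k \<omega>) (\<lambda>k. X k \<omega>)"
        if "\<omega> \<in> space \<Omega>" for \<omega> using run that by (simp add: s_def)
    qed (use assms gderiv smooth' lower L \<delta> s1 \<eta> in auto)
    have "(\<Sum>k=1..K. \<integral>\<omega>. nuclear_norm (grad (X k \<omega>)) \<partial>\<Omega>)
        \<le> 9 * (real K * s * \<sigma>h\<^sup>2) / \<delta> + 43 / 8 * (N * (real K * \<sigma>h * sqrt s))"
      using K \<sigma>h_sq \<Delta>_eq \<sigma>h N(2) by (intro sum_nuclear_norm_grad_le) (auto simp: \<Delta>_def)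
    \<comment> \<open>The choice of \<open>\<delta>\<close> trades one factor
      \<open>\<sigma>h\<close> for \<open>N / \<tau>\<close>. The term is then of order
      \<open>s\<close>, and \<open>s \<le> sqrt s\<close> brings it to the common rate.\<close>
    also have "9 * (real K * s * \<sigma>h\<^sup>2) / \<delta> = 9 / \<tau> * (N * (real K * \<sigma>h * s))"
      using \<sigma>h \<tau> N by (simp add: \<delta>_eq power2_eq_square)
    also have "\<dots> \<le> 9 / \<tau> * (N * (real K * \<sigma>h * sqrt s))"
      using s0 s1 \<sigma>h \<tau> N K by (intro mult_left_mono) (auto simp: real_le_rsqrt power2_eq_square mult_left_le)
    finally have "(1 / real K) * (\<Sum>k=1..K. \<integral>\<omega>. nuclear_norm (grad (X k \<omega>)) \<partial>\<Omega>)
        \<le> (1 / real K) * ((9 / \<tau> + 43 / 8) * (N * (real K * \<sigma>h * sqrt s)))"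
      using K by (intro mult_left_mono) (auto simp: algebra_simps)
    also have "\<dots> = (9 / \<tau> + 43 / 8) * (N * (\<sigma>h * sqrt s))" using K by simp
    also have "\<dots> \<le> (4 + 11 / \<tau>) * (N * (\<sigma>h * sqrt s))"
    proof (intro mult_right_mono)
      \<comment> \<open>Since \<open>43 / 8 = 4 + 11 / 8\<close>, the excess \<open>11 / 8\<close>
        fits into \<open>2 / \<tau>\<close>.\<close>
      have "1 \<le> 1 / \<tau>" using \<tau> by simp
      then show "9 / \<tau> + 43 / 8 \<le> 4 + 11 / \<tau>" by (simp add: add_divide_distrib[symmetric] field_simps)
    qed (use N \<sigma>h s0 in auto)
    finally show ?thesis
      unfolding root using integrable_nuclear_norm_grad by (simp add: N_def mult.assoc)
  qed
qed

end
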